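(* Let $\lambda>1$, $g=\frac{(\lambda-1)^2}{\lambda^2+1}$, and let $\mathbf{M}=\mathbf{W}+\lambda\mathbf{u}\mathbf{u}^\top$, where $\mathbf{W}\sim\mathrm{GOE}(d)$ and $\mathbf{u}$ uniform on $\mathcal{S}^{d-1}$ are independent. Then for every query algorithm (as in the context) and all $\delta\in(0,1/e)$, $$\mathbb{E}_{\mathbf{u}}\,\mathsf{P}_{\mathbf{u}}\left[\exists k\ge1:\ \mathbf{u}^\top\mathsf{V}_k\mathsf{V}_k^\top\mathbf{u}\ \ge\ 32\,\lambda^{4k}\,\frac{g^{-1}(\log\delta^{-1}+g^{-1/2})}{d}\right]\le\delta .$$ (Here $k$ ranges over the rounds of the algorithm.)
   Context: $\mathcal{S}^{d-1}$ is the unit sphere of $\mathbb{R}^d$. $\mathrm{GOE}(d)$: random symmetric $\mathbf{W}$ with independent entries $\{\mathbf{W}_{ij}\}_{i\le j}$, $\mathbf{W}_{ij}\sim\mathcal{N}(0,1/d)$ for $i<j$, $\mathbf{W}_{ii}\sim\mathcal{N}(0,2/d)$. Query algorithm: in rounds $k=1,2,\dots,N$ ($N\le d$) it plays unit vectors $\mathsf{v}^{(k)}$ orthogonal to $\mathsf{v}^{(1)},\dots,\mathsf{v}^{(k-1)}$ and observes $\mathsf{w}^{(k)}=(I-\mathsf{V}_{k-1}\mathsf{V}_{k-1}^\top)\mathbf{M}\mathsf{v}^{(k)}$, where $\mathsf{V}_k=[\mathsf{v}^{(1)}|\cdots|\mathsf{v}^{(k)}]\in\mathbb{R}^{d\times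 k}$ has orthonormal columns ($\mathsf V_0$ empty). The query $\mathsf{v}^{(k+1)}$ is a deterministic measurable function of the history $\mathsf{Z}_k=(\mathsf{v}^{(j)},\mathsf{w}^{(j)})_{1\le j\le k}$. $\mathsf{P}_u$ denotes the law of the history conditional on $\mathbf{u}=u$. *)

theory Defs
  imports "HOL-Probability.Probability"
begin

section \<open>Random matrix model\<close>

definition outer :: "real ^ 'n \<Rightarrow> real ^ 'n \<Rightarrow> real ^ 'n ^ 'n"
  where "outer x y = (\<chi> i j. x $ i * y $ j)"

text \<open>
  The linear order on the index type only serves to single out the entries on and above the
  diagonal, which are independent; the ones below are filled in by symmetry.  The second argument of
  \<^const>\<open>normal_density\<close> is the standard deviation, not the variance.
\<close>

definition goe :: "(real ^ 'n::{finite,linorder} ^ 'n::{finite,linorder}) measure"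
  where "goe =
    distr
      (PiM {(i, j). i \<le> j}
        (\<lambda>(i, j). density lborel
          (normal_density 0 (sqrt ((if i = j then 2 else 1) / real CARD('n))))))
      borel
      (\<lambda>x. \<chi> i j. x (min i j, max i j))"

text \<open>
  The uniform distribution on the unit sphere is the normalised surface (cone) measure: the radial
  projection of the uniform distribution on the unit ball.
\<close>

definition uniform_sphere :: "(real ^ 'n) measure"
  where "uniform_sphere = distr (uniform_measure lborel (ball 0 1)) borel (\<lambda>x. x /\<^sub>R norm x)"

section \<open>Query algorithms\<close>

text \<open>
  A history after \<open>k\<close> rounds is an element of the product space over \<open>{1..k}\<close>; its entry at \<open>j\<close> is
  the pair of the \<open>j\<close>-th query and the \<open>j\<close>-th observation.
\<close>

type_synonym 'n history = "nat \<Rightarrow> (real ^ 'n) \<times> (real ^ 'n)"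

definition history_space :: "nat \<Rightarrow> 'n::finite history measure"
  where "history_space k = PiM {1..k} (\<lambda>_. borel \<Otimes>\<^sub>M borel)"

text \<open>The matrix \<open>V\<^sub>k V\<^sub>k\<^sup>T\<close>, where \<open>V\<^sub>k\<close> has the first \<open>k\<close> queries as its columns.\<close>

definition query_gram :: "'n history \<Rightarrow> nat \<Rightarrow> real ^ 'n ^ 'n"
  where "query_gram z k = (\<Sum>j\<in>{1..k}. outer (fst (z j)) (fst (z j)))"

text \<open>
  An algorithm is given by its query maps: \<open>q k\<close> maps the history of the first \<open>k\<close> rounds to the
  query of round \<open>k + 1\<close>.
\<close>

primrec run :: "(nat \<Rightarrow> 'n history \<Rightarrow> real ^ 'n) \<Rightarrow> real ^ 'n ^ 'n \<Rightarrow> nat \<Rightarrow> 'n history"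
  where
    "run q M 0 = (\<lambda>_. undefined)"
  | "run q M (Suc k) =
      (let z = run q M k; v = q k z
       in z(Suc k := (v, (mat 1 - query_gram z k) *v (M *v v))))"

text \<open>
  Orthonormality is only required of the queries actually played, on every symmetric input matrix.
\<close>

definition query_algorithm :: "nat \<Rightarrow> (nat \<Rightarrow> 'n history \<Rightarrow> real ^ 'n::finite) \<Rightarrow> bool"
  where "query_algorithm N q \<longleftrightarrow>
    N \<le> CARD('n) \<and>
    (\<forall>k<N. q k \<in> borel_measurable (history_space k)) \<and>
    (\<forall>M. transpose M = M \<longrightarrow>
      (\<forall>k\<in>{1..N}. norm (fst (run q M N k)) = 1 \<and>
        (\<forall>j\<in>{1..<k}. fst (run q M N k) \<bullet> fst (run q M N j) = 0)))"

text \<open>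
  The law of the history conditional on the spike being \<open>u\<close>.  As the noise is independent of the
  spike, this is the law of the run on \<open>W + \<lambda> u u\<^sup>T\<close> with \<open>u\<close> held fixed.
\<close>

definition history_law ::
    "nat \<Rightarrow> (nat \<Rightarrow> 'n history \<Rightarrow> real ^ 'n::{finite,linorder}) \<Rightarrow> real
      \<Rightarrow> real ^ 'n::{finite,linorder} \<Rightarrow> 'n history measure"
  where "history_law N q lam u =
    distr goe (history_space N) (\<lambda>W. run q (W + lam *\<^sub>R outer u u) N)"

section \<open>Measurability\<close>

lemma borel_measurable_outer [measurable]:
  "(\<lambda>(x, y). outer x y :: real ^ 'n ^ 'n) \<in> borel_measurable (borel \<Otimes>\<^sub>M borel)"
  unfolding outer_def borel_prod split_def
  by (intro borel_measurable_continuous_onI continuous_intros)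

lemma borel_measurable_mult_vec [measurable]:
  "(\<lambda>(A :: real ^ 'n ^ 'm, x). A *v x) \<in> borel_measurable (borel \<Otimes>\<^sub>M borel)"
  unfolding matrix_vector_mult_def borel_prod split_def
  by (intro borel_measurable_continuous_onI continuous_intros)

lemma measurable_fst_history [measurable]:
  "j \<in> {1..k} \<Longrightarrow> (\<lambda>z :: 'n::finite history. fst (z j)) \<in> borel_measurable (history_space k)"
  unfolding history_space_def by measurable

lemma borel_measurable_query_gram [measurable]:
  assumes "k \<le> m"
  shows "(\<lambda>z :: 'n::finite history. query_gram z k) \<in> borel_measurable (history_space m)"
proof -
  have "(\<lambda>z :: 'n history. outer (fst (z j)) (fst (z j))) \<in> borel_measurable (history_space m)"
    if "j \<in> {1..k}" for j
  proof -
    have [measurable]: "(\<lambda>z :: 'n history. fst (z j)) \<in> borel_measurable (history_space m)"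
      using that assms by (intro measurable_fst_history) auto
    show ?thesis by measurable
  qed
  then show ?thesis unfolding query_gram_def by (intro borel_measurable_sum) auto
qed

lemma measurable_run:
  fixes q :: "nat \<Rightarrow> 'n history \<Rightarrow> real ^ 'n::finite"
  assumes "query_algorithm N q" and "k \<le> N"
  shows "(\<lambda>M. run q M k) \<in> borel \<rightarrow>\<^sub>M history_space k"
  using assms(2)
proof (induction k)
  case 0
  show ?case unfolding history_space_def by (simp add: space_PiM)
next
  case (Suc k)
  then have [measurable]: "(\<lambda>M. run q M k) \<in> borel \<rightarrow>\<^sub>M history_space k" by simp
  have [measurable]: "q k \<in> borel_measurable (history_space k)"
    using assms(1) Suc.prems unfolding query_algorithm_def by simp
  have g[measurable]: "(\<lambda>z :: 'n history. query_gram z k) \<in> borel_measurable (history_space k)"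
    by (rule borel_measurable_query_gram) simp
  have *: "{1..Suc k} = insert (Suc k) {1..k}" by auto
  have p: "(\<lambda>M. (q k (run q M k), (mat 1 - query_gram (run q M k) k) *v (M *v q k (run q M k))))
      \<in> borel \<rightarrow>\<^sub>M borel \<Otimes>\<^sub>M borel"
    by measurable
  have r: "(\<lambda>M. run q M k) \<in> borel \<rightarrow>\<^sub>M PiM {1..k} (\<lambda>_. borel \<Otimes>\<^sub>M borel)"
    using Suc.IH Suc.prems by (simp add: history_space_def)
  show ?case
    unfolding history_space_def * run.simps Let_def
    by (rule measurable_fun_upd[OF _ r p]) simp
qed

lemma measurable_upper_to_matrix:
  "(\<lambda>x. \<chi> i j. x (min i j, max i j)) \<in>
     borel_measurable (PiM {(i, j :: 'n::{finite,linorder}). i \<le> j}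
       (\<lambda>(i, j). density lborel (normal_density 0 (s i j))))"
  (is "_ \<in> borel_measurable ?P")
proof -
  have entry: "(\<lambda>x. x (min a b, max a b)) \<in> borel_measurable ?P" for a b
  proof -
    have "(min a b, max a b) \<in> {(i, j). i \<le> j}" by (cases a b rule: le_cases) (auto simp: min_def max_def)
    from measurable_component_singleton[OF this,
        of "\<lambda>(i, j). density lborel (normal_density 0 (s i j))"]
    show ?thesis by (simp cong: measurable_cong_sets)
  qed
  show ?thesis
    by (subst borel_measurable_euclidean_space) (auto simp: Basis_vec_def inner_axis entry)
qed

lemma prob_space_goe: "prob_space (goe :: (real ^ 'n::{finite,linorder} ^ 'n::{finite,linorder}) measure)"
  unfolding goe_def
  by (intro prob_space.prob_space_distr prob_space_PiM measurable_upper_to_matrix)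
     (auto intro!: prob_space_normal_density)

lemma prob_space_uniform_sphere: "prob_space (uniform_sphere :: (real ^ 'n) measure)"
proof -
  have "emeasure lborel (ball (0 :: real ^ 'n) 1) \<noteq> 0"
    using unit_ball_vol_pos[of "real CARD('n)"] by (simp add: emeasure_ball del: unit_ball_vol_pos)
  moreover have "emeasure lborel (ball (0 :: real ^ 'n) 1) \<noteq> \<infinity>"
    using emeasure_lborel_ball_finite[of "0 :: real ^ 'n" 1] by simp
  ultimately show ?thesis
    unfolding uniform_sphere_def
    by (intro prob_space.prob_space_distr prob_space_uniform_measure) simp_all
qed

lemma AE_uniform_sphere: "AE u in uniform_sphere. norm (u :: real ^ 'n) = 1"
proof -
  have "AE x in uniform_measure lborel (ball 0 1). norm (x /\<^sub>R norm (x :: real ^ 'n)) = 1"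
    using AE_lborel_singleton[of "0 :: real ^ 'n"]
    by (intro AE_uniform_measureI) auto
  then show ?thesis unfolding uniform_sphere_def by (subst AE_distr_iff) auto
qed

lemma sets_goe [measurable_cong]: "sets goe = sets borel"
  by (simp add: goe_def)

lemma sets_uniform_sphere [measurable_cong]: "sets uniform_sphere = sets borel"
  by (simp add: uniform_sphere_def)

lemma prob_space_history_law:
  assumes "query_algorithm N q"
  shows "prob_space (history_law N q lam u)"
proof -
  note [measurable] = measurable_run[OF assms order_refl]
  show ?thesis
    unfolding history_law_def
    by (intro prob_space.prob_space_distr prob_space_goe) measurable
qed

lemma sets_overlap_event:
  "{(u :: real ^ 'n::finite, z). z \<in> space (history_space N) \<and>
      (\<exists>k\<in>{1..N}. c k \<le> u \<bullet> (query_gram z k *v u))}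
    \<in> sets (borel \<Otimes>\<^sub>M history_space N)"
proof -
  have [measurable]: "(\<lambda>(u :: real ^ 'n, z). u \<bullet> (query_gram z k *v u))
      \<in> borel_measurable (borel \<Otimes>\<^sub>M history_space N)" if "k \<in> {1..N}" for k
  proof -
    have [measurable]: "(\<lambda>z :: 'n history. query_gram z k) \<in> borel_measurable (history_space N)"
      by (rule borel_measurable_query_gram) (use that in auto)
    show ?thesis by measurable
  qed
  let ?S = "{x \<in> space (borel \<Otimes>\<^sub>M history_space N).
    \<exists>k\<in>{1..N}. c k \<le> (case x of (u :: real ^ 'n, z) \<Rightarrow> u \<bullet> (query_gram z k *v u))}"
  have "?S \<in> sets (borel \<Otimes>\<^sub>M history_space N)"
    by measurable
  also have "?S = {(u, z). z \<in> space (history_space N) \<and>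
      (\<exists>k\<in>{1..N}. c k \<le> u \<bullet> (query_gram z k *v u))}"
    by (auto simp: space_pair_measure)
  finally show ?thesis .
qed

text \<open>
  Averaging \<^const>\<open>history_law\<close> over a uniform spike gives the probability under the joint law of
  independent spike and noise.
\<close>

lemma nn_integral_history_law:
  assumes "query_algorithm N q"
  shows "(\<integral>\<^sup>+ u. emeasure (history_law N q lam u)
        {z \<in> space (history_space N). \<exists>k\<in>{1..N}. c k \<le> u \<bullet> (query_gram z k *v u)} \<partial>uniform_sphere)
    = emeasure (uniform_sphere \<Otimes>\<^sub>M goe)
        {(u, W). \<exists>k\<in>{1..N}. c k \<le> u \<bullet> (query_gram (run q (W + lam *\<^sub>R outer u u) N) k *v u)}"
proof -
  note run [measurable] = measurable_run[OF assms order_refl]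
  note ev [measurable] = sets_overlap_event[of N c]
  interpret goe: prob_space goe by (rule prob_space_goe)
  let ?f = "\<lambda>(u, W). (u, run q (W + lam *\<^sub>R outer u u) N)"
  let ?E = "{(u, z). z \<in> space (history_space N) \<and> (\<exists>k\<in>{1..N}. c k \<le> u \<bullet> (query_gram z k *v u))}"
  let ?R = "{(u, W). \<exists>k\<in>{1..N}. c k \<le> u \<bullet> (query_gram (run q (W + lam *\<^sub>R outer u u) N) k *v u)}"
  have f: "?f \<in> uniform_sphere \<Otimes>\<^sub>M goe \<rightarrow>\<^sub>M borel \<Otimes>\<^sub>M history_space N"
    by measurable
  have sp: "run q M N \<in> space (history_space N)" for M
    using measurable_space[OF run] by simp
  have UNIV: "space (uniform_sphere \<Otimes>\<^sub>M goe) = UNIV"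
    by (simp add: space_pair_measure uniform_sphere_def goe_def)
  have "?R = ?f -` ?E \<inter> space (uniform_sphere \<Otimes>\<^sub>M goe)"
    by (simp add: UNIV vimage_def split_def sp)
  then have R: "?R \<in> sets (uniform_sphere \<Otimes>\<^sub>M goe)"
    by (simp only: measurable_sets[OF f ev])
  have "emeasure (history_law N q lam u)
        {z \<in> space (history_space N). \<exists>k\<in>{1..N}. c k \<le> u \<bullet> (query_gram z k *v u)}
      = emeasure goe (Pair u -` ?R)" for u
  proof -
    let ?A = "{z \<in> space (history_space N). \<exists>k\<in>{1..N}. c k \<le> u \<bullet> (query_gram z k *v u)}"
    have "Pair u -` ?E = ?A" by (simp add: vimage_def)
    then have A: "?A \<in> sets (history_space N)" using sets_Pair1[OF ev, of u] by simp
    have "(\<lambda>W. run q (W + lam *\<^sub>R outer u u) N) -` ?A \<inter> space goe = Pair u -` ?R"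
      by (simp add: goe_def vimage_def sp)
    moreover have "(\<lambda>W. run q (W + lam *\<^sub>R outer u u) N) \<in> goe \<rightarrow>\<^sub>M history_space N"
      by measurable
    ultimately show ?thesis using A by (simp only: history_law_def emeasure_distr)
  qed
  then show ?thesis by (simp only: goe.emeasure_pair_measure_alt[OF R])
qed

end

theory Submission
  imports Defs
begin

text \<open>
  A GOE matrix is the symmetrisation of a matrix \<open>A\<close> with independent standard normal entries.  Let
  \<open>P\<close> be the orthogonal projection onto the complement of the first \<open>k\<close> queries.  Replacing the block
  \<open>P A P\<close> by an independent copy changes neither the first \<open>k\<close> rounds nor the law of \<open>A\<close>, so the
  likelihood ratio of the history against pure noise is the Cameron-Martin density for the observed
  part \<open>S - P S P\<close> of the spike \<open>S\<close>.  Its \<open>p\<close>-th moment is small on the event that the overlap of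
  the spike with the first \<open>k\<close> queries is still small.  Under pure noise the queries are independent
  of the spike, so the next overlap is that of a uniform vector with a fixed subspace, whose tail is
  a chi-square tail.  Splitting according to the first round at which the threshold is exceeded, a
  Hoelder type argument with \<open>p = \<lambda>\<close> bounds each round, and the bounds sum to less than \<open>\<delta>\<close>.
\<close>

section \<open>Standard Gaussian measure\<close>

text \<open>On the event that the overlap after \<open>k\<close> rounds is at most
  \<open>\<tau> k / d\<close>, the moment of the likelihood ratio, raised to \<open>1 / p\<close>,
  costs the exponent \<open>(p - 1) * lam\<^sup>2 * \<tau> k / 2\<close>; the null tail, raised to
  \<open>1 - 1 / p\<close>, gains almost \<open>(1 - 1 / p) * \<tau> (Suc k) / 2\<close>. The gain
  dominates once \<open>\<tau> (Suc k)\<close> exceeds \<open>p * lam\<^sup>2 * \<tau> k\<close>.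
  Thresholds growing by \<open>lam ^ 4\<close> leave the window \<open>1 < p < lam\<^sup>2\<close>,
  and \<open>p = lam\<close> is its geometric midpoint.

  The obstacle is adaptivity: the observed directions depend on the noise. Instead of disintegrating
  the history round by round, everything stays on the space of full matrices, where the change of
  measure is explicit, and the part of the density that involves the unseen block is integrated out.

  Leaving \<open>A\<close> unsymmetrised makes it a standard Gaussian vector for the Frobenius inner
  product, so translations and orthogonal projections act on it without weights. The spike
  \<open>lam\<close> on the GOE scale becomes \<open>lam * sqrt (d / 2)\<close> on the scale of
  \<open>A\<close>, and the factor \<open>d\<close> in its square cancels the \<open>1 / d\<close>
  in the thresholds.\<close>

definition gauss :: "'a::euclidean_space measure"
  where "gauss = density lborel (\<lambda>x. ennreal (\<Prod>b\<in>Basis. std_normal_density (x \<bullet> b)))"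

lemma sets_gauss [simp, measurable_cong]: "sets gauss = sets borel"
  by (simp add: gauss_def)

lemma space_gauss [simp]: "space gauss = UNIV"
  by (simp add: gauss_def)

lemma gauss_density_eq:
  fixes x :: "'a::euclidean_space"
  shows "(\<Prod>b\<in>Basis. std_normal_density (x \<bullet> b))
    = (1 / sqrt (2 * pi)) ^ DIM('a) * exp (- (norm x)\<^sup>2 / 2)"
proof -
  have "(norm x)\<^sup>2 = (\<Sum>b\<in>Basis. (x \<bullet> b)\<^sup>2)"
    unfolding power2_norm_eq_inner euclidean_inner[of x x] by (simp add: power2_eq_square)
  then have "exp (- (norm x)\<^sup>2 / 2) = (\<Prod>b\<in>Basis. exp (- (x \<bullet> b)\<^sup>2 / 2))"
    by (simp add: exp_sum[symmetric] sum_negf sum_divide_distrib)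
  then show ?thesis
    by (simp add: std_normal_density_def prod_dividef power_one_over divide_simps)
qed

lemma nn_integral_gauss:
  fixes f :: "'a::euclidean_space \<Rightarrow> ennreal"
  assumes [measurable]: "f \<in> borel_measurable borel"
  shows "(\<integral>\<^sup>+ x. f x \<partial>gauss)
    = (\<integral>\<^sup>+ x. ennreal ((1 / sqrt (2 * pi)) ^ DIM('a) * exp (- (norm x)\<^sup>2 / 2)) * f x \<partial>lborel)"
  unfolding gauss_def by (subst nn_integral_density) (auto simp: gauss_density_eq)

text \<open>Boxes suffice: total mass, one-dimensional marginals and independence of the coordinates
  are all read off from this identity.\<close>

lemma emeasure_gauss_box:
  fixes A :: "'a::euclidean_space \<Rightarrow> real set"
  assumes A: "\<And>b. b \<in> Basis \<Longrightarrow> A b \<in> sets borel"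
  shows "emeasure gauss {x::'a. \<forall>b\<in>Basis. x \<bullet> b \<in> A b}
    = (\<Prod>b\<in>Basis. emeasure (density lborel std_normal_density) (A b))"
proof -
  have [measurable]: "{x::'a. \<forall>b\<in>Basis. x \<bullet> b \<in> A b} \<in> sets borel"
  proof -
    have "{x::'a. \<forall>b\<in>Basis. x \<bullet> b \<in> A b} = (\<Inter>b\<in>Basis. (\<lambda>x. x \<bullet> b) -` A b \<inter> space borel)"
      by auto
    also have "\<dots> \<in> sets borel"
      by (intro sets.finite_INT measurable_sets[where A=borel] A) auto
    finally show ?thesis .
  qed
  have "emeasure gauss {x::'a. \<forall>b\<in>Basis. x \<bullet> b \<in> A b}
    = (\<integral>\<^sup>+x. (\<Prod>b\<in>Basis. ennreal (std_normal_density ((x::'a) \<bullet> b)) * indicator (A b) (x \<bullet> b)) \<partial>lborel)"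
  proof -
    have "indicator {x::'a. \<forall>b\<in>Basis. x \<bullet> b \<in> A b} x = (\<Prod>b\<in>Basis. indicator (A b) (x \<bullet> b) :: ennreal)" for x
    proof (cases "\<forall>b\<in>Basis. x \<bullet> b \<in> A b")
      case False
      then obtain b where "b \<in> Basis" "x \<bullet> b \<notin> A b" by auto
      then have "(\<Prod>b\<in>Basis. indicator (A b) (x \<bullet> b) :: ennreal) = 0"
        by (intro prod_zero finite_Basis bexI[of _ b]) simp_all
      then show ?thesis using False by simp
    qed simp
    then show ?thesis
      unfolding gauss_def
      by (subst emeasure_density)
        (auto simp: prod.distrib prod_ennreal intro!: nn_integral_cong)
  qed
  also have "\<dots> = (\<Prod>b\<in>Basis. (\<integral>\<^sup>+x. ennreal (std_normal_density x) * indicator (A b) x \<partial>lborel))"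
    using A by (intro nn_integral_lborel_prod) auto
  also have "\<dots> = (\<Prod>b\<in>Basis. emeasure (density lborel std_normal_density) (A b))"
    using A by (intro prod.cong refl) (simp add: emeasure_density)
  finally show ?thesis .
qed

lemma prob_space_gauss: "prob_space (gauss :: 'a::euclidean_space measure)"
proof
  interpret N: prob_space "density lborel std_normal_density"
    by (rule prob_space_normal_density) simp
  show "emeasure gauss (space (gauss :: 'a measure)) = 1"
    using emeasure_gauss_box[of "\<lambda>_::'a. UNIV"] N.emeasure_space_1 by simp
qed

lemma nn_integral_lborel_translate:
  fixes f :: "'a::euclidean_space \<Rightarrow> ennreal"
  assumes [measurable]: "f \<in> borel_measurable borel"
  shows "(\<integral>\<^sup>+ x. f (x + c) \<partial>lborel) = (\<integral>\<^sup>+ x. f x \<partial>lborel)"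
proof -
  have "(\<integral>\<^sup>+ x. f x \<partial>lborel) = (\<integral>\<^sup>+ x. f x \<partial>distr lborel borel ((+) c))"
    by (simp only: lborel_distr_plus)
  also have "\<dots> = (\<integral>\<^sup>+ x. f (x + c) \<partial>lborel)"
    by (subst nn_integral_distr) (auto simp: add.commute)
  finally show ?thesis by simp
qed

text \<open>Translation invariance of \<open>lborel\<close> moves the shift from \<open>f\<close>
  into the density; completing the square splits off the exponential factor.\<close>

lemma gauss_cameron_martin:
  fixes f :: "'a::euclidean_space \<Rightarrow> ennreal"
  assumes [measurable]: "f \<in> borel_measurable borel"
  shows "(\<integral>\<^sup>+ x. f (x + s) \<partial>gauss)
    = (\<integral>\<^sup>+ x. f x * ennreal (exp (s \<bullet> x - (norm s)\<^sup>2 / 2)) \<partial>gauss)"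
proof -
  let ?C = "(1 / sqrt (2 * pi)) ^ DIM('a)"
  let ?g = "\<lambda>x::'a. ennreal (?C * exp (- (norm (x - s))\<^sup>2 / 2)) * f x"
  have "(\<integral>\<^sup>+ x. f (x + s) \<partial>gauss) = (\<integral>\<^sup>+ x. ?g (x + s) \<partial>lborel)"
    by (subst nn_integral_gauss) auto
  also have "\<dots> = (\<integral>\<^sup>+ x. ?g x \<partial>lborel)"
    by (rule nn_integral_lborel_translate) measurable
  also have "\<dots> = (\<integral>\<^sup>+ x. ennreal (?C * exp (- (norm x)\<^sup>2 / 2))
      * (f x * ennreal (exp (s \<bullet> x - (norm s)\<^sup>2 / 2))) \<partial>lborel)"
  proof (rule nn_integral_cong)
    fix x :: 'a
    have "exp (- (norm (x - s))\<^sup>2 / 2) = exp (- (norm x)\<^sup>2 / 2) * exp (s \<bullet> x - (norm s)\<^sup>2 / 2)"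
      unfolding exp_add[symmetric]
      by (simp add: power2_norm_eq_inner inner_diff_left inner_diff_right inner_commute field_simps)
    then show "?g x = ennreal (?C * exp (- (norm x)\<^sup>2 / 2))
      * (f x * ennreal (exp (s \<bullet> x - (norm s)\<^sup>2 / 2)))"
      by (simp add: ennreal_mult mult_ac)
  qed
  also have "\<dots> = (\<integral>\<^sup>+ x. f x * ennreal (exp (s \<bullet> x - (norm s)\<^sup>2 / 2)) \<partial>gauss)"
    by (subst nn_integral_gauss) auto
  finally show ?thesis .
qed

text \<open>The Cameron-Martin density has total mass 1, which is the formula up to a constant
  factor.\<close>

lemma gauss_mgf:
  fixes s :: "'a::euclidean_space"
  shows "(\<integral>\<^sup>+ x. ennreal (exp (s \<bullet> x)) \<partial>gauss) = ennreal (exp ((norm s)\<^sup>2 / 2))"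
proof -
  interpret prob_space "gauss :: 'a measure" by (rule prob_space_gauss)
  have *: "exp (s \<bullet> x) = exp ((norm s)\<^sup>2 / 2) * exp (s \<bullet> x - (norm s)\<^sup>2 / 2)" for x
    by (simp add: exp_add[symmetric])
  have "(\<integral>\<^sup>+ x. ennreal (exp (s \<bullet> x)) \<partial>gauss)
    = ennreal (exp ((norm s)\<^sup>2 / 2)) * (\<integral>\<^sup>+ x. 1 * ennreal (exp (s \<bullet> x - (norm s)\<^sup>2 / 2)) \<partial>gauss)"
    unfolding * by (subst nn_integral_cmult[symmetric]) (auto simp: ennreal_mult)
  also have "\<dots> = ennreal (exp ((norm s)\<^sup>2 / 2)) * (\<integral>\<^sup>+ x. 1 \<partial>(gauss :: 'a measure))"
    by (subst gauss_cameron_martin[symmetric, where f="\<lambda>_. 1"]) auto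
  finally show ?thesis using emeasure_space_1 by simp
qed

text \<open>The pair rotation \<open>(x, y) \<mapsto> (x - p x + p y, y - p y - p x)\<close> is a product of three shears,
  each of which preserves Lebesgue measure by translation invariance.\<close>

lemma nn_integral_lborel_pair_rotate:
  fixes p :: "'a::euclidean_space \<Rightarrow> 'a" and f :: "'a \<Rightarrow> 'a \<Rightarrow> ennreal"
  assumes p: "linear p" "\<And>x. p (p x) = p x"
    and f [measurable]: "case_prod f \<in> borel_measurable (borel \<Otimes>\<^sub>M borel)"
  shows "(\<integral>\<^sup>+ x. \<integral>\<^sup>+ y. f (x - p x + p y) (y - p y - p x) \<partial>lborel \<partial>lborel)
    = (\<integral>\<^sup>+ x. \<integral>\<^sup>+ y. f x y \<partial>lborel \<partial>lborel)"
proof -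
  have [measurable]: "p \<in> borel_measurable borel"
    by (intro borel_measurable_continuous_onI linear_continuous_on linear_conv_bounded_linear[THEN iffD1] p(1))
  have add: "p (x + y) = p x + p y" and diff: "p (x - y) = p x - p y" for x y
    by (rule linear_add[OF p(1)], rule linear_diff[OF p(1)])
  have [measurable]: "(\<lambda>x. f (F x) (G x)) \<in> borel_measurable M"
    if [measurable]: "F \<in> borel_measurable M" "G \<in> borel_measurable M" for F G and M :: "('a \<times> 'a) measure"
    using measurable_compose[OF measurable_Pair[OF that] f] by simp
  note Fub = lborel_pair.Fubini'
  have "(\<integral>\<^sup>+ x. \<integral>\<^sup>+ y. f x y \<partial>lborel \<partial>lborel) = (\<integral>\<^sup>+ y. \<integral>\<^sup>+ x. f x y \<partial>lborel \<partial>lborel)"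
    by (rule Fub[symmetric]) measurable
  also have "\<dots> = (\<integral>\<^sup>+ y. \<integral>\<^sup>+ x. f (x + p y) y \<partial>lborel \<partial>lborel)"
    by (intro nn_integral_cong nn_integral_lborel_translate[symmetric, where f="\<lambda>x. f x y" for y]) measurable
  also have "\<dots> = (\<integral>\<^sup>+ x. \<integral>\<^sup>+ y. f (x + p y) y \<partial>lborel \<partial>lborel)"
    by (rule Fub) measurable
  also have "\<dots> = (\<integral>\<^sup>+ x. \<integral>\<^sup>+ y. f (x + p (y + - p x)) (y + - p x) \<partial>lborel \<partial>lborel)"
    by (intro nn_integral_cong nn_integral_lborel_translate[symmetric, where f="\<lambda>y. f (x + p y) y" for x]) measurable
  also have "\<dots> = (\<integral>\<^sup>+ y. \<integral>\<^sup>+ x. f (x + p (y + - p x)) (y + - p x) \<partial>lborel \<partial>lborel)"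
    by (rule Fub[symmetric]) measurable
  also have "\<dots> = (\<integral>\<^sup>+ y. \<integral>\<^sup>+ x. f ((x + p y) + p (y + - p (x + p y))) (y + - p (x + p y)) \<partial>lborel \<partial>lborel)"
    by (intro nn_integral_cong
        nn_integral_lborel_translate[symmetric, where f="\<lambda>x. f (x + p (y + - p x)) (y + - p x)" for y]) measurable
  also have "\<dots> = (\<integral>\<^sup>+ x. \<integral>\<^sup>+ y. f ((x + p y) + p (y + - p (x + p y))) (y + - p (x + p y)) \<partial>lborel \<partial>lborel)"
    by (rule Fub) measurable
  also have "\<dots> = (\<integral>\<^sup>+ x. \<integral>\<^sup>+ y. f (x - p x + p y) (y - p y - p x) \<partial>lborel \<partial>lborel)"
    by (simp add: add diff p(2) algebra_simps)
  finally show ?thesis by simp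
qed

text \<open>Since \<open>p\<close> is an orthogonal projection, the substitution is the identity on
  its kernel and a quarter turn of the pair on its range. It thus preserves the product density as
  well as Lebesgue measure, and the integrand depends on one rotated coordinate only.\<close>

lemma gauss_resample:
  fixes p :: "'a::euclidean_space \<Rightarrow> 'a" and f :: "'a \<Rightarrow> ennreal"
  assumes p: "linear p" "\<And>x. p (p x) = p x" "\<And>x y. p x \<bullet> y = x \<bullet> p y"
    and [measurable]: "f \<in> borel_measurable borel"
  shows "(\<integral>\<^sup>+ x. \<integral>\<^sup>+ y. f (x - p x + p y) \<partial>gauss \<partial>gauss) = (\<integral>\<^sup>+ x. f x \<partial>gauss)"
proof -
  interpret prob_space "gauss :: 'a measure" by (rule prob_space_gauss)
  have [measurable]: "p \<in> borel_measurable borel"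
    by (intro borel_measurable_continuous_onI linear_continuous_on linear_conv_bounded_linear[THEN iffD1] p(1))
  define D where "D x = ennreal ((1 / sqrt (2 * pi)) ^ DIM('a) * exp (- (norm (x::'a))\<^sup>2 / 2))" for x
  have D [measurable]: "D \<in> borel_measurable borel" unfolding D_def by measurable
  have G: "(\<integral>\<^sup>+ x. g x \<partial>gauss) = (\<integral>\<^sup>+ x. D x * g x \<partial>lborel)"
    if "g \<in> borel_measurable borel" for g
    unfolding D_def by (rule nn_integral_gauss[OF that])
  have DD: "D (x - p x + p y) * D (y - p y - p x) = D x * D y" for x y
  proof -
    have "y \<bullet> p x = x \<bullet> p y" by (metis p(3) inner_commute)
    then have n: "(norm (x - p x + p y))\<^sup>2 + (norm (y - p y - p x))\<^sup>2 = (norm x)\<^sup>2 + (norm y)\<^sup>2"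
      unfolding power2_norm_eq_inner
      by (simp add: inner_diff_left inner_diff_right inner_add_left inner_add_right p(2,3) inner_commute[of y x])
    have "(K * exp (- (norm (x - p x + p y))\<^sup>2 / 2)) * (K * exp (- (norm (y - p y - p x))\<^sup>2 / 2))
      = K * K * exp (- ((norm (x - p x + p y))\<^sup>2 + (norm (y - p y - p x))\<^sup>2) / 2)" for K :: real
      by (simp add: exp_add[symmetric] add_divide_distrib diff_divide_distrib)
    also have "\<dots> K = (K * exp (- (norm x)\<^sup>2 / 2)) * (K * exp (- (norm y)\<^sup>2 / 2))" for K :: real
      unfolding n by (simp add: exp_add[symmetric] add_divide_distrib diff_divide_distrib)
    finally show ?thesis
      unfolding D_def by (simp only: ennreal_mult'[symmetric] mult_nonneg_nonneg zero_le_power divide_nonneg_nonneg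
         exp_ge_zero real_sqrt_ge_zero pi_ge_zero)
  qed
  have GG: "(\<integral>\<^sup>+ x. \<integral>\<^sup>+ y. g x y \<partial>gauss \<partial>gauss) = (\<integral>\<^sup>+ x. \<integral>\<^sup>+ y. D x * D y * g x y \<partial>lborel \<partial>lborel)"
    if [measurable]: "case_prod g \<in> borel_measurable (borel \<Otimes>\<^sub>M borel)" for g
  proof -
    have [measurable]: "g x \<in> borel_measurable borel" for x
      using measurable_compose[OF measurable_Pair1' that, of x] by simp
    have "(\<integral>\<^sup>+ x. \<integral>\<^sup>+ y. g x y \<partial>gauss \<partial>gauss) = (\<integral>\<^sup>+ x. \<integral>\<^sup>+ y. D y * g x y \<partial>lborel \<partial>gauss)"
      by (intro nn_integral_cong G) measurable
    also have "\<dots> = (\<integral>\<^sup>+ x. D x * (\<integral>\<^sup>+ y. D y * g x y \<partial>lborel) \<partial>lborel)"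
      by (rule G) measurable
    also have "\<dots> = (\<integral>\<^sup>+ x. \<integral>\<^sup>+ y. D x * D y * g x y \<partial>lborel \<partial>lborel)"
      by (intro nn_integral_cong) (simp add: nn_integral_cmult[symmetric] mult.assoc)
    finally show ?thesis .
  qed
  have "(\<integral>\<^sup>+ x. \<integral>\<^sup>+ y. f (x - p x + p y) \<partial>gauss \<partial>gauss)
     = (\<integral>\<^sup>+ x. \<integral>\<^sup>+ y. D x * D y * f (x - p x + p y) \<partial>lborel \<partial>lborel)"
    by (rule GG) measurable
  also have "\<dots> = (\<integral>\<^sup>+ x. \<integral>\<^sup>+ y. D (x - p x + p y) * D (y - p y - p x) * f (x - p x + p y) \<partial>lborel \<partial>lborel)"
    by (simp only: DD)
  also have "\<dots> = (\<integral>\<^sup>+ x. \<integral>\<^sup>+ y. D x * D y * f x \<partial>lborel \<partial>lborel)"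
    by (rule nn_integral_lborel_pair_rotate[OF p(1,2), where f="\<lambda>x y. D x * D y * f x"]) measurable
  also have "\<dots> = (\<integral>\<^sup>+ x. \<integral>\<^sup>+ y. f x \<partial>(gauss :: 'a measure) \<partial>gauss)"
    by (rule GG[symmetric]) measurable
  finally show ?thesis using emeasure_space_1 by simp
qed

lemma distr_gauss_component:
  fixes b :: "'a::euclidean_space"
  assumes b: "b \<in> Basis"
  shows "distr gauss borel (\<lambda>x. x \<bullet> b) = density lborel std_normal_density"
proof (rule measure_eqI)
  interpret N: prob_space "density lborel std_normal_density"
    by (rule prob_space_normal_density) simp
  fix X assume "X \<in> sets (distr gauss borel (\<lambda>x::'a. x \<bullet> b))"
  then have X[measurable]: "X \<in> sets borel" by simp
  have "emeasure (distr gauss borel (\<lambda>x. x \<bullet> b)) X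
    = emeasure gauss {x. \<forall>c\<in>Basis. x \<bullet> c \<in> (if c = b then X else UNIV)}"
    using b by (subst emeasure_distr) (auto intro!: arg_cong[where f="emeasure gauss"])
  also have "\<dots> = (\<Prod>c\<in>Basis. emeasure (density lborel std_normal_density) (if c = b then X else UNIV))"
    by (rule emeasure_gauss_box) auto
  also have "\<dots> = (\<Prod>c\<in>Basis. if c = b then emeasure (density lborel std_normal_density) X else 1)"
    using N.emeasure_space_1 by (intro prod.cong) auto
  also have "\<dots> = emeasure (density lborel std_normal_density) X"
    using b by simp
  finally show "emeasure (distr gauss borel (\<lambda>x. x \<bullet> b)) X
    = emeasure (density lborel std_normal_density) X" .
qed simp

lemma indep_vars_gauss:
  "prob_space.indep_vars gauss (\<lambda>_. borel) (\<lambda>b x. x \<bullet> b) (Basis :: 'a::euclidean_space set)"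
proof -
  interpret prob_space "gauss :: 'a measure" by (rule prob_space_gauss)
  interpret N: prob_space "density lborel std_normal_density"
    by (rule prob_space_normal_density) simp
  interpret P: product_prob_space "\<lambda>_::'a. density lborel std_normal_density" ..
  have "distr gauss (\<Pi>\<^sub>M b\<in>Basis. borel) (\<lambda>x. \<lambda>b\<in>Basis. x \<bullet> b)
    = (\<Pi>\<^sub>M b\<in>(Basis::'a set). density lborel std_normal_density)"
  proof (rule P.PiM_eqI)
    fix A :: "'a \<Rightarrow> real set" assume "\<And>b. b \<in> Basis \<Longrightarrow> A b \<in> sets (density lborel std_normal_density)"
    then have A: "A b \<in> sets borel" if "b \<in> Basis" for b using that by simp
    then have "emeasure (distr gauss (\<Pi>\<^sub>M b\<in>Basis. borel) (\<lambda>x. \<lambda>b\<in>Basis. x \<bullet> b)) (Pi\<^sub>E Basis A)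
      = emeasure gauss {x::'a. \<forall>b\<in>Basis. x \<bullet> b \<in> A b}"
      by (subst emeasure_distr) (auto intro!: sets_PiM_I_finite arg_cong[where f="emeasure gauss"] measurable_restrict simp: PiE_iff)
    then show "emeasure (distr gauss (\<Pi>\<^sub>M b\<in>Basis. borel) (\<lambda>x. \<lambda>b\<in>Basis. x \<bullet> b)) (Pi\<^sub>E Basis A)
      = (\<Prod>b\<in>Basis. emeasure (density lborel std_normal_density) (A b))"
      by (simp add: emeasure_gauss_box A)
  qed (auto intro!: sets_PiM_cong)
  then show ?thesis
    by (subst indep_vars_iff_distr_eq_PiM') (auto simp: distr_gauss_component cong: PiM_cong)
qed

section \<open>Overlap of a uniform vector with a subspace\<close>

text \<open>Uniqueness of Haar measure: the double integral of \<open>f x * g (x + y)\<close> is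
  evaluated twice, using invariance of \<open>lborel\<close> in \<open>y\<close> and of
  \<open>M\<close> in \<open>x\<close>. The common mass of the ball is positive and finite, so it
  cancels.\<close>

lemma translation_invariant_eq:
  fixes M :: "'a::euclidean_space measure"
  assumes sets [measurable_cong]: "sets M = sets borel"
    and sf: "sigma_finite_measure M"
    and inv: "\<And>c f. f \<in> borel_measurable borel \<Longrightarrow> (\<integral>\<^sup>+ x. f (x + c) \<partial>M) = (\<integral>\<^sup>+ x. f x \<partial>M)"
    and ball: "emeasure M (ball 0 1) = emeasure lborel (ball (0::'a) 1)"
    and g [measurable]: "g \<in> borel_measurable borel"
  shows "(\<integral>\<^sup>+ x. g x \<partial>M) = (\<integral>\<^sup>+ x. g x \<partial>lborel)"
proof -
  define f where "f = (indicator (ball 0 1) :: 'a \<Rightarrow> ennreal)"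
  have f [measurable]: "f \<in> borel_measurable borel" unfolding f_def by (intro borel_measurable_indicator) simp
  let ?B = "emeasure lborel (ball (0::'a) 1)"
  interpret M: sigma_finite_measure M by (rule sf)
  interpret P: pair_sigma_finite M lborel ..
  have [measurable_cong]: "sets (M \<Otimes>\<^sub>M lborel) = sets (borel \<Otimes>\<^sub>M borel)"
    by (intro sets_pair_measure_cong sets sets_lborel)
  have "?B * (\<integral>\<^sup>+ y. g y \<partial>lborel) = (\<integral>\<^sup>+ x. f x * (\<integral>\<^sup>+ y. g y \<partial>lborel) \<partial>M)"
    by (subst nn_integral_multc, measurable) (simp_all add: ball sets f_def)
  also have "\<dots> = (\<integral>\<^sup>+ x. f x * (\<integral>\<^sup>+ y. g (y + x) \<partial>lborel) \<partial>M)"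
    by (simp add: nn_integral_lborel_translate)
  also have "\<dots> = (\<integral>\<^sup>+ x. \<integral>\<^sup>+ y. f x * g (x + y) \<partial>lborel \<partial>M)"
    by (intro nn_integral_cong) (simp add: nn_integral_cmult[symmetric] add.commute)
  also have "\<dots> = (\<integral>\<^sup>+ y. \<integral>\<^sup>+ x. f x * g (x + y) \<partial>M \<partial>lborel)"
    by (rule P.Fubini'[symmetric]) measurable
  also have "\<dots> = (\<integral>\<^sup>+ y. \<integral>\<^sup>+ x. f (x + y - y) * g (x + y) \<partial>M \<partial>lborel)"
    by simp
  also have "\<dots> = (\<integral>\<^sup>+ y. \<integral>\<^sup>+ x. f (x - y) * g x \<partial>M \<partial>lborel)"
    by (intro nn_integral_cong inv[where f="\<lambda>x. f (x - y) * g x" for y]) measurable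
  also have "\<dots> = (\<integral>\<^sup>+ x. \<integral>\<^sup>+ y. f (x - y) * g x \<partial>lborel \<partial>M)"
    by (rule P.Fubini') measurable
  \<comment> \<open>The ball is symmetric about 0, so \<open>x - y\<close> may be replaced by its
    negative.\<close>
  also have "\<dots> = (\<integral>\<^sup>+ x. \<integral>\<^sup>+ y. f (y + - x) * g x \<partial>lborel \<partial>M)"
    by (intro nn_integral_cong arg_cong2[where f="(*)"]) (auto simp: f_def indicator_def dist_norm norm_minus_commute)
  also have "\<dots> = (\<integral>\<^sup>+ x. \<integral>\<^sup>+ y. f y * g x \<partial>lborel \<partial>M)"
    by (intro nn_integral_cong nn_integral_lborel_translate[where f="\<lambda>y. f y * g x" for x]) measurable
  also have "\<dots> = (\<integral>\<^sup>+ x. ?B * g x \<partial>M)"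
    by (intro nn_integral_cong) (subst nn_integral_multc, auto simp: f_def intro!: borel_measurable_indicator)
  also have "\<dots> = ?B * (\<integral>\<^sup>+ x. g x \<partial>M)"
    by (rule nn_integral_cmult) measurable
  finally have *: "?B * (\<integral>\<^sup>+ y. g y \<partial>lborel) = ?B * (\<integral>\<^sup>+ x. g x \<partial>M)" .
  have "?B \<noteq> 0"
    using unit_ball_vol_pos[of "real DIM('a)"] by (simp add: emeasure_ball del: unit_ball_vol_pos)
  moreover have "?B \<noteq> \<top>"
    using emeasure_lborel_ball_finite[of "0::'a" 1] by simp
  ultimately show ?thesis
    using * by (simp add: ennreal_mult_cancel_left)
qed

text \<open>The image measure under \<open>h\<close> is again translation invariant, because a shift
  by \<open>h c'\<close> after \<open>h\<close> is a shift by \<open>c'\<close> before it, and the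
  unit ball keeps its mass because \<open>h\<close> preserves norms. Uniqueness then applies,
  without a determinant.\<close>

lemma nn_integral_lborel_orthogonal:
  fixes h :: "'a::euclidean_space \<Rightarrow> 'a" and g :: "'a \<Rightarrow> ennreal"
  assumes h: "orthogonal_transformation h" and g [measurable]: "g \<in> borel_measurable borel"
  shows "(\<integral>\<^sup>+ x. g (h x) \<partial>lborel) = (\<integral>\<^sup>+ x. g x \<partial>lborel)"
proof -
  have lin: "linear h" using h by (rule orthogonal_transformation_linear)
  then have [measurable]: "h \<in> borel_measurable borel"
    by (intro borel_measurable_continuous_onI linear_continuous_on linear_conv_bounded_linear[THEN iffD1])
  have norm: "norm (h x) = norm x" for x
    using h by (rule orthogonal_transformation_norm)
  have surj: "surj h" using h by (rule orthogonal_transformation_surj)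
  have vim: "h -` ball 0 r = ball 0 r" for r
    by (auto simp: norm)
  have "(\<integral>\<^sup>+ x. g x \<partial>distr lborel borel h) = (\<integral>\<^sup>+ x. g x \<partial>lborel)"
  proof (rule translation_invariant_eq)
    show "sigma_finite_measure (distr lborel borel h)"
    proof (rule sigma_finite_measure.intro, intro exI conjI ballI)
      let ?A = "range (\<lambda>n::nat. ball (0::'a) (real n))"
      show "countable ?A" by simp
      show "?A \<subseteq> sets (distr lborel borel h)" by auto
      have "\<exists>n::nat. x \<in> ball 0 (real n)" for x :: 'a
        using reals_Archimedean2[of "norm x"] by auto
      then show "\<Union> ?A = space (distr lborel borel h)" by auto
      fix a assume "a \<in> ?A"
      then obtain n where a: "a = ball 0 (real n)" by auto
      show "emeasure (distr lborel borel h) a \<noteq> \<infinity>"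
        unfolding a using emeasure_lborel_ball_finite[of "0::'a" "real n"]
        by (subst emeasure_distr) (simp_all add: vim)
    qed
    show "emeasure (distr lborel borel h) (ball 0 1) = emeasure lborel (ball (0::'a) 1)"
      by (subst emeasure_distr) (simp_all add: vim)
    fix c and f :: "'a \<Rightarrow> ennreal" assume [measurable]: "f \<in> borel_measurable borel"
    obtain c' where c': "c = h c'" using surj by auto
    have "(\<integral>\<^sup>+ x. f (x + c) \<partial>distr lborel borel h) = (\<integral>\<^sup>+ x. f (h (x + c')) \<partial>lborel)"
      by (subst nn_integral_distr) (auto simp: c' linear_add[OF lin])
    also have "\<dots> = (\<integral>\<^sup>+ x. f (h x) \<partial>lborel)"
      by (rule nn_integral_lborel_translate) measurable
    also have "\<dots> = (\<integral>\<^sup>+ x. f x \<partial>distr lborel borel h)"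
      by (subst nn_integral_distr) auto
    finally show "(\<integral>\<^sup>+ x. f (x + c) \<partial>distr lborel borel h) = (\<integral>\<^sup>+ x. f x \<partial>distr lborel borel h)" .
  qed auto
  then show ?thesis by (subst (asm) nn_integral_distr) auto
qed

text \<open>A diagonal scaling of one coordinate, written as a rank-one perturbation of the identity
  so that an orthogonal map can carry it to any unit vector.\<close>

lemma nn_integral_lborel_stretch_Basis:
  fixes b :: "'a::euclidean_space" and g :: "'a \<Rightarrow> ennreal"
  assumes b: "b \<in> Basis" and s: "0 < s" and [measurable]: "g \<in> borel_measurable borel"
  shows "(\<integral>\<^sup>+ x. g x \<partial>lborel) = ennreal s * (\<integral>\<^sup>+ x. g (x + ((s - 1) * (b \<bullet> x)) *\<^sub>R b) \<partial>lborel)"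
proof -
  define c where "c j = (if j = b then s else 1)" for j :: 'a
  have T: "0 + (\<Sum>j\<in>Basis. (c j * (x \<bullet> j)) *\<^sub>R j) = x + ((s - 1) * (b \<bullet> x)) *\<^sub>R b" for x
  proof -
    have "(\<Sum>j\<in>Basis. (c j * (x \<bullet> j)) *\<^sub>R j)
      = (\<Sum>j\<in>Basis. (x \<bullet> j) *\<^sub>R j + (if j = b then ((s - 1) * (x \<bullet> b)) *\<^sub>R b else 0))"
      by (intro sum.cong) (auto simp: c_def algebra_simps)
    also have "\<dots> = x + ((s - 1) * (b \<bullet> x)) *\<^sub>R b"
      using b by (simp add: sum.distrib euclidean_representation) (simp add: inner_commute)
    finally show ?thesis by simp
  qed
  have p: "(\<Prod>j\<in>Basis. \<bar>c j\<bar>) = s"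
    using b s by (simp add: c_def if_distrib[of abs] cong: if_cong)
  have [measurable]: "(\<lambda>x. x + ((s - 1) * (b \<bullet> x)) *\<^sub>R b) \<in> borel_measurable borel"
    by measurable
  have "lborel = density (distr lborel borel (\<lambda>x. x + ((s - 1) * (b \<bullet> x)) *\<^sub>R b)) (\<lambda>_. ennreal s)"
    using lborel_affine_euclidean[of c 0] s unfolding T p by (auto simp: c_def)
  then have "(\<integral>\<^sup>+ x. g x \<partial>lborel) = (\<integral>\<^sup>+ x. g x \<partial>density (distr lborel borel (\<lambda>x. x + ((s - 1) * (b \<bullet> x)) *\<^sub>R b)) (\<lambda>_. ennreal s))"
    by simp
  also have "\<dots> = ennreal s * (\<integral>\<^sup>+ x. g (x + ((s - 1) * (b \<bullet> x)) *\<^sub>R b) \<partial>lborel)"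
    by (simp add: nn_integral_density nn_integral_distr nn_integral_cmult)
  finally show ?thesis .
qed

lemma nn_integral_lborel_stretch:
  fixes v :: "real ^ 'n" and g :: "real ^ 'n \<Rightarrow> ennreal"
  assumes v: "norm v = 1" and s: "0 < s" and [measurable]: "g \<in> borel_measurable borel"
  shows "(\<integral>\<^sup>+ x. g x \<partial>lborel) = ennreal s * (\<integral>\<^sup>+ x. g (x + ((s - 1) * (v \<bullet> x)) *\<^sub>R v) \<partial>lborel)"
proof -
  obtain b :: "real ^ 'n" where b: "b \<in> Basis" using nonempty_Basis by blast
  obtain h :: "real ^ 'n \<Rightarrow> real ^ 'n" where h: "orthogonal_transformation h" "h b = v"
    using orthogonal_transformation_exists_1[of b v] b v by auto
  have lin: "linear h" using h(1) by (rule orthogonal_transformation_linear)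
  then have [measurable]: "h \<in> borel_measurable borel"
    by (intro borel_measurable_continuous_onI linear_continuous_on linear_conv_bounded_linear[THEN iffD1])
  have inner: "v \<bullet> h x = b \<bullet> x" for x
    using h by (auto simp: orthogonal_transformation_def)
  have "(\<integral>\<^sup>+ x. g x \<partial>lborel) = (\<integral>\<^sup>+ x. g (h x) \<partial>lborel)"
    by (rule nn_integral_lborel_orthogonal[symmetric, OF h(1)]) measurable
  also have "\<dots> = ennreal s * (\<integral>\<^sup>+ x. g (h (x + ((s - 1) * (b \<bullet> x)) *\<^sub>R b)) \<partial>lborel)"
    by (rule nn_integral_lborel_stretch_Basis[OF b s]) measurable
  also have "(\<integral>\<^sup>+ x. g (h (x + ((s - 1) * (b \<bullet> x)) *\<^sub>R b)) \<partial>lborel)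
    = (\<integral>\<^sup>+ x. g (h x + ((s - 1) * (v \<bullet> h x)) *\<^sub>R v) \<partial>lborel)"
    by (simp add: linear_add[OF lin] linear_scale[OF lin] h(2) inner)
  also have "\<dots> = (\<integral>\<^sup>+ x. g (x + ((s - 1) * (v \<bullet> x)) *\<^sub>R v) \<partial>lborel)"
    by (rule nn_integral_lborel_orthogonal[OF h(1), where g="\<lambda>x. g (x + ((s - 1) * (v \<bullet> x)) *\<^sub>R v)"]) measurable
  finally show ?thesis .
qed

text \<open>Single stretches are composed. By orthogonality the coefficient along the new vector is
  not altered by the others, so the displacements add and the Jacobians multiply.\<close>

lemma nn_integral_lborel_stretch_orthonormal:
  fixes v :: "'i \<Rightarrow> real ^ 'n" and g :: "real ^ 'n \<Rightarrow> ennreal"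
  assumes fin: "finite I" and v: "\<And>i. i \<in> I \<Longrightarrow> norm (v i) = 1"
    and orth: "\<And>i j. i \<in> I \<Longrightarrow> j \<in> I \<Longrightarrow> i \<noteq> j \<Longrightarrow> v i \<bullet> v j = 0"
    and s: "0 < s" and g: "g \<in> borel_measurable borel"
  shows "(\<integral>\<^sup>+ x. g x \<partial>lborel)
    = ennreal (s ^ card I) * (\<integral>\<^sup>+ x. g (x + (s - 1) *\<^sub>R (\<Sum>i\<in>I. (v i \<bullet> x) *\<^sub>R v i)) \<partial>lborel)"
  using fin v orth g
proof (induction I arbitrary: g)
  case (insert a I)
  note [measurable] = insert.prems(3)
  let ?T = "\<lambda>x. x + (s - 1) *\<^sub>R (\<Sum>i\<in>I. (v i \<bullet> x) *\<^sub>R v i)"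
  have "(\<integral>\<^sup>+ x. g x \<partial>lborel) = ennreal s * (\<integral>\<^sup>+ x. g (x + ((s - 1) * (v a \<bullet> x)) *\<^sub>R v a) \<partial>lborel)"
    using insert.prems s by (intro nn_integral_lborel_stretch) auto
  also have "(\<integral>\<^sup>+ x. g (x + ((s - 1) * (v a \<bullet> x)) *\<^sub>R v a) \<partial>lborel)
    = ennreal (s ^ card I) * (\<integral>\<^sup>+ x. g (?T x + ((s - 1) * (v a \<bullet> ?T x)) *\<^sub>R v a) \<partial>lborel)"
    using insert.prems by (intro insert.IH) auto
  also have "(\<lambda>x. ?T x + ((s - 1) * (v a \<bullet> ?T x)) *\<^sub>R v a)
    = (\<lambda>x. x + (s - 1) *\<^sub>R (\<Sum>i\<in>insert a I. (v i \<bullet> x) *\<^sub>R v i))"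
  proof
    fix x
    have va: "v a \<bullet> v i = 0" if "i \<in> I" for i using insert that by (metis insertCI)
    have aT: "v a \<bullet> ?T x = v a \<bullet> x"
      by (simp add: inner_add_right inner_sum_right va)
    show "?T x + ((s - 1) * (v a \<bullet> ?T x)) *\<^sub>R v a = x + (s - 1) *\<^sub>R (\<Sum>i\<in>insert a I. (v i \<bullet> x) *\<^sub>R v i)"
      unfolding aT using insert.hyps by (simp add: scaleR_add_right)
  qed
  finally show ?case
    using insert.hyps s by (simp add: ennreal_mult mult.assoc)
qed simp

text \<open>Pythagoras: the component in the span is multiplied by \<open>1 + c\<close> and the
  orthogonal rest is kept. The value \<open>c = -1\<close> yields Bessel's inequality.\<close>

lemma norm_stretch_orthonormal:
  fixes v :: "'i \<Rightarrow> 'a::real_inner"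
  assumes fin: "finite I" and v: "\<And>i. i \<in> I \<Longrightarrow> norm (v i) = 1"
    and orth: "\<And>i j. i \<in> I \<Longrightarrow> j \<in> I \<Longrightarrow> i \<noteq> j \<Longrightarrow> v i \<bullet> v j = 0"
  shows "(norm (x + c *\<^sub>R (\<Sum>i\<in>I. (v i \<bullet> x) *\<^sub>R v i)))\<^sup>2
    = (norm x)\<^sup>2 + ((1 + c)\<^sup>2 - 1) * (\<Sum>i\<in>I. (v i \<bullet> x)\<^sup>2)"
proof -
  let ?y = "\<Sum>i\<in>I. (v i \<bullet> x) *\<^sub>R v i"
  have xy: "x \<bullet> ?y = (\<Sum>i\<in>I. (v i \<bullet> x)\<^sup>2)"
    by (simp add: inner_sum_right power2_eq_square inner_commute)
  have vy: "v i \<bullet> ?y = v i \<bullet> x" if i: "i \<in> I" for i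
  proof -
    have "v i \<bullet> v j = (if j = i then 1 else 0)" if "j \<in> I" for j
      using v[OF i] orth[OF i that] by (auto simp: norm_eq_1)
    then have "v i \<bullet> ?y = (\<Sum>j\<in>I. if j = i then v i \<bullet> x else 0)"
      by (auto simp: inner_sum_right intro!: sum.cong)
    then show ?thesis using fin i by simp
  qed
  have yy: "?y \<bullet> ?y = (\<Sum>i\<in>I. (v i \<bullet> x)\<^sup>2)"
    by (subst inner_sum_left) (simp add: vy power2_eq_square)
  show ?thesis
    unfolding power2_norm_eq_inner inner_add_left inner_add_right inner_scaleR_left inner_scaleR_right
      yy xy inner_commute[of ?y x]
    by (simp add: power2_eq_square algebra_simps)
qed

text \<open>
  With \<open>s = sqrt (1 - \<beta>)\<close> and \<open>r = 1 / sqrt (1 - \<beta> x)\<close>, scaling by \<open>r\<close> and then by \<open>s\<close> along the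
  vectors \<open>v i\<close> maps the part of the unit ball over the event into the unit ball, so the
  probability is at most the inverse Jacobian.
\<close>

lemma uniform_sphere_overlap:
  fixes v :: "'i \<Rightarrow> real ^ 'n"
  assumes fin: "finite I" and v: "\<And>i. i \<in> I \<Longrightarrow> norm (v i) = 1"
    and orth: "\<And>i j. i \<in> I \<Longrightarrow> j \<in> I \<Longrightarrow> i \<noteq> j \<Longrightarrow> v i \<bullet> v j = 0"
    and x: "0 < x" and \<beta>: "0 \<le> \<beta>" "\<beta> < 1"
  shows "emeasure uniform_sphere {u. x \<le> (\<Sum>i\<in>I. (v i \<bullet> u)\<^sup>2)}
    \<le> ennreal (exp (- \<beta> * x * real CARD('n) / 2) * (1 - \<beta>) powr (- real (card I) / 2))"
proof -
  let ?Q = "\<lambda>u. (\<Sum>i\<in>I. (v i \<bullet> u)\<^sup>2)" and ?d = "CARD('n)"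
  let ?B = "ball (0::real^'n) 1"
  let ?S = "{u. x \<le> ?Q u}"
  let ?C = "{y \<in> ?B. x \<le> ?Q (y /\<^sub>R norm y)}"
  have [measurable]: "?S \<in> sets borel" "?C \<in> sets borel" by measurable
  have Qscale: "?Q (c *\<^sub>R y) = c\<^sup>2 * ?Q y" for c y
    by (simp add: power_mult_distrib sum_distrib_left)
  have Qle: "?Q y \<le> (norm y)\<^sup>2" for y
  proof -
    have "0 \<le> (norm (y + (- 1) *\<^sub>R (\<Sum>i\<in>I. (v i \<bullet> y) *\<^sub>R v i)))\<^sup>2" by (rule zero_le_power2)
    also have "\<dots> = (norm y)\<^sup>2 + ((1 + (- 1))\<^sup>2 - 1) * ?Q y"
      by (rule norm_stretch_orthonormal[OF fin v orth])
    finally show ?thesis by simp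
  qed
  have B0: "emeasure lborel ?B \<noteq> 0"
    using unit_ball_vol_pos[of "real CARD('n)"] by (simp add: emeasure_ball del: unit_ball_vol_pos)
  have Bfin: "emeasure lborel ?B \<noteq> \<top>"
    using emeasure_lborel_ball_finite[of "0 :: real ^ 'n" 1] by simp
  have eq: "emeasure uniform_sphere ?S = emeasure lborel ?C / emeasure lborel ?B"
  proof -
    have "emeasure uniform_sphere ?S = emeasure (uniform_measure lborel ?B) {y. x \<le> ?Q (y /\<^sub>R norm y)}"
      unfolding uniform_sphere_def by (subst emeasure_distr) (auto simp: vimage_def)
    also have "\<dots> = emeasure lborel ?C / emeasure lborel ?B"
      by (subst emeasure_uniform_measure) (auto intro!: arg_cong2[where f="(/)"] arg_cong[where f="emeasure lborel"])
    finally show ?thesis .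
  qed
  show ?thesis
  \<comment> \<open>For \<open>x > 1\<close> the event is empty by Bessel's inequality;
    \<open>x \<le> 1\<close> ensures \<open>\<beta> * x < 1\<close>, so that \<open>r\<close> makes
    sense.\<close>
  proof (cases "x \<le> 1")
    case False
    have "?C = {}"
    proof -
      have "?Q (y /\<^sub>R norm y) \<le> 1" for y :: "real^'n"
        using Qle[of "y /\<^sub>R norm y"] by (cases "y = 0") auto
      thus ?thesis using False by (blast intro: order_trans)
    qed
    then have "emeasure lborel ?C = 0" by (metis emeasure_empty)
    then show ?thesis unfolding eq by simp
  next
    case True
    define r where "r = 1 / sqrt (1 - \<beta> * x)"
    define s where "s = sqrt (1 - \<beta>)"
    have bx: "\<beta> * x < 1" using \<beta> x True by (smt (verit) mult_left_le mult_nonneg_nonneg)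
    have r: "0 < r" "r\<^sup>2 = 1 / (1 - \<beta> * x)" using bx by (auto simp: r_def power_divide)
    have s: "0 < s" "s\<^sup>2 = 1 - \<beta>" using \<beta> by (auto simp: s_def)
    let ?T = "\<lambda>y. y + (s - 1) *\<^sub>R (\<Sum>i\<in>I. (v i \<bullet> y) *\<^sub>R v i)"
    have "?T (r *\<^sub>R y) \<in> ?B" if y: "y \<in> ?C" for y
    proof -
      have y0: "y \<noteq> 0" and y1: "norm y < 1" using y x by (auto intro: ccontr)
      have "x * (norm y)\<^sup>2 \<le> ?Q y"
        using y y0 unfolding Qscale by (auto simp: field_simps power_inverse)
      have "(norm (?T (r *\<^sub>R y)))\<^sup>2 = (norm (r *\<^sub>R y))\<^sup>2 + ((1 + (s - 1))\<^sup>2 - 1) * ?Q (r *\<^sub>R y)"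
        by (rule norm_stretch_orthonormal[OF fin v orth])
      also have "\<dots> = r\<^sup>2 * ((norm y)\<^sup>2 - \<beta> * ?Q y)"
        unfolding Qscale by (simp add: s(2) power_mult_distrib algebra_simps)
      also have "\<dots> \<le> r\<^sup>2 * ((norm y)\<^sup>2 - \<beta> * (x * (norm y)\<^sup>2))"
        using \<open>x * (norm y)\<^sup>2 \<le> ?Q y\<close> \<beta> by (intro mult_left_mono diff_left_mono) auto
      \<comment> \<open>\<open>r\<close> is the dilation with
        \<open>r\<^sup>2 * (1 - \<beta> * x) = 1\<close>: contracting along the \<open>v i\<close>
        removes at least the fraction \<open>\<beta> * x\<close> of the squared norm, which
        \<open>r\<close> restores.\<close>
      also have "\<dots> = (norm y)\<^sup>2"
        using bx unfolding r(2) by (simp add: field_simps)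
      also have "\<dots> < 1\<^sup>2" using y1 by (intro power_strict_mono) auto
      finally show ?thesis by (simp add: power_less_imp_less_base)
    qed
    then have sub: "?C \<subseteq> {y. ?T (r *\<^sub>R y) \<in> ?B}" by blast
    have [measurable]: "?T \<in> borel_measurable borel" by measurable
    have scale: "(\<integral>\<^sup>+ y. g y \<partial>lborel) = ennreal (r ^ ?d) * (\<integral>\<^sup>+ y. g (r *\<^sub>R y) \<partial>lborel)"
      if [measurable]: "g \<in> borel_measurable borel" for g :: "real^'n \<Rightarrow> ennreal"
    proof -
      have "(\<integral>\<^sup>+ y. g y \<partial>lborel) = (\<integral>\<^sup>+ y. g y \<partial>density (distr lborel borel (\<lambda>x. 0 + r *\<^sub>R x)) (\<lambda>_. ennreal (\<bar>r\<bar> ^ DIM(real^'n))))"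
        using lborel_affine[of r "0::real^'n"] r(1) by simp
      also have "\<dots> = ennreal (r ^ ?d) * (\<integral>\<^sup>+ y. g (r *\<^sub>R y) \<partial>lborel)"
        using r(1) by (simp add: nn_integral_density nn_integral_distr nn_integral_cmult)
      finally show ?thesis .
    qed
    have indB: "(indicator ?B :: real^'n \<Rightarrow> ennreal) \<in> borel_measurable borel"
      by (intro borel_measurable_indicator) simp
    have indT: "(\<lambda>y. indicator ?B (?T y) :: ennreal) \<in> borel_measurable borel"
      by (rule measurable_compose[OF _ indB]) measurable
    have vol: "emeasure lborel {y. ?T (r *\<^sub>R y) \<in> ?B} = (\<integral>\<^sup>+ y. indicator ?B (?T (r *\<^sub>R y)) \<partial>lborel)"
    proof -
      have [measurable]: "(\<lambda>y. ?T (r *\<^sub>R y)) \<in> borel_measurable borel" by measurable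
      have "{y. ?T (r *\<^sub>R y) \<in> ?B} = (\<lambda>y. ?T (r *\<^sub>R y)) -` ?B \<inter> space borel" by auto
      also have "\<dots> \<in> sets lborel" by (subst sets_lborel, rule measurable_sets[where A=borel]) auto
      finally have "emeasure lborel {y. ?T (r *\<^sub>R y) \<in> ?B} = (\<integral>\<^sup>+ y. indicator {y. ?T (r *\<^sub>R y) \<in> ?B} y \<partial>lborel)"
        by (rule nn_integral_indicator[symmetric])
      then show ?thesis by (simp add: indicator_def)
    qed
    have "ennreal (s ^ card I) * ennreal (r ^ ?d) * emeasure lborel ?C
      \<le> ennreal (s ^ card I) * ennreal (r ^ ?d) * emeasure lborel {y. ?T (r *\<^sub>R y) \<in> ?B}"
      by (intro mult_left_mono emeasure_mono sub) auto
    also have "\<dots> = ennreal (s ^ card I) * (ennreal (r ^ ?d) * (\<integral>\<^sup>+ y. indicator ?B (?T (r *\<^sub>R y)) \<partial>lborel))"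
      unfolding vol mult.assoc ..
    also have "\<dots> = ennreal (s ^ card I) * (\<integral>\<^sup>+ y. indicator ?B (?T y) \<partial>lborel)"
      by (simp only: scale[OF indT])
    also have "\<dots> = (\<integral>\<^sup>+ y. indicator ?B y \<partial>lborel)"
      by (rule nn_integral_lborel_stretch_orthonormal[OF fin v orth s(1) indB, symmetric])
    also have "\<dots> = emeasure lborel ?B" by simp
    finally have main: "ennreal (s ^ card I * r ^ ?d) * emeasure lborel ?C \<le> emeasure lborel ?B"
      using s r by (simp add: ennreal_mult)
    have pos: "0 < s ^ card I * r ^ ?d" using s r by simp
    have "emeasure lborel ?C / emeasure lborel ?B \<le> ennreal (1 / (s ^ card I * r ^ ?d))"
    proof -
      obtain a where a: "emeasure lborel ?C = ennreal a" "0 \<le> a"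
        by (metis (no_types, lifting) Bfin emeasure_mono ennreal_cases mem_Collect_eq neq_top_trans
            open_ball borel_open sets_lborel subsetI)
      obtain b where b: "emeasure lborel ?B = ennreal b" "0 \<le> b"
        using Bfin by (cases "emeasure lborel ?B") auto
      have b0: "0 < b" using b B0 by (auto simp: less_le)
      have "s ^ card I * r ^ ?d * a \<le> b"
        using main a b pos by (simp add: ennreal_mult[symmetric])
      then have "a / b \<le> 1 / (s ^ card I * r ^ ?d)"
        using pos b0 by (simp add: field_simps)
      then show ?thesis using a b b0 by (simp add: divide_ennreal ennreal_leI)
    qed
    \<comment> \<open>This is the Chernoff bound for a chi-square variable with
      \<open>card I\<close> degrees of freedom at level \<open>x * d\<close>: the power of
      \<open>1 - \<beta>\<close> is its moment generating function at
      \<open>\<beta> / 2\<close>.\<close>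
    also have "1 / (s ^ card I * r ^ ?d) \<le> exp (- \<beta> * x * real ?d / 2) * (1 - \<beta>) powr (- real (card I) / 2)"
    proof -
      have "1 / r ^ ?d = sqrt (1 - \<beta> * x) ^ ?d"
        using bx by (simp add: r_def power_one_over)
      also have "\<dots> \<le> exp (- \<beta> * x / 2) ^ ?d"
      proof (intro power_mono)
        have "1 - \<beta> * x \<le> (exp (- \<beta> * x / 2))\<^sup>2"
          using exp_ge_add_one_self[of "- \<beta> * x"] by (simp add: power2_eq_square exp_add[symmetric])
        then show "sqrt (1 - \<beta> * x) \<le> exp (- \<beta> * x / 2)" by (rule real_le_lsqrt[rotated 1]) auto
      qed (use bx in simp)
      also have "\<dots> = exp (- \<beta> * x * real ?d / 2)"
        by (simp add: exp_of_nat_mult[symmetric] mult_ac)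
      finally have 1: "1 / r ^ ?d \<le> exp (- \<beta> * x * real ?d / 2)" .
      have 2: "1 / s ^ card I = (1 - \<beta>) powr (- real (card I) / 2)"
        using \<beta> by (simp add: s_def powr_half_sqrt[symmetric] powr_powr powr_realpow[symmetric] powr_minus_divide)
      have "1 / (s ^ card I * r ^ ?d) = (1 / r ^ ?d) * (1 / s ^ card I)" by simp
      also have "\<dots> \<le> exp (- \<beta> * x * real ?d / 2) * (1 / s ^ card I)"
        using s by (intro mult_right_mono 1) simp
      finally show ?thesis unfolding 2 .
    qed
    finally show ?thesis unfolding eq by (simp add: ennreal_leI)
  qed
qed

section \<open>The GOE as a symmetrised Gaussian matrix\<close>

text \<open>With standard normal entries the scaling gives variance
  \<open>2 / (2 * d) = 1 / d\<close> off the diagonal and \<open>4 / (2 * d) = 2 / d\<close> on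
  it.\<close>

definition symmat :: "real ^ 'n ^ 'n \<Rightarrow> real ^ 'n ^ 'n"
  where "symmat A = (1 / sqrt (2 * real CARD('n))) *\<^sub>R (A + transpose A)"

lemma symmat_nth: "symmat A $ i $ j = (A $ i $ j + A $ j $ i) / sqrt (2 * real CARD('n))"
  for A :: "real ^ 'n ^ 'n"
  by (simp add: symmat_def transpose_def)

lemma linear_symmat: "linear symmat"
  by (rule linearI) (simp_all add: vec_eq_iff symmat_nth add_divide_distrib algebra_simps)

lemma measurable_symmat [measurable]: "symmat \<in> borel_measurable borel"
  by (intro borel_measurable_continuous_onI linear_continuous_on linear_conv_bounded_linear[THEN iffD1] linear_symmat)

lemma borel_measurable_matrix_nth [measurable]:
  "(\<lambda>A :: real ^ 'n ^ 'm. A $ i $ j) \<in> borel_measurable borel"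
  by (intro borel_measurable_continuous_onI continuous_intros)

lemma distr_gauss_symmat_entry:
  fixes i j :: "'n::finite"
  shows "distr gauss borel (\<lambda>A :: real ^ 'n ^ 'n. symmat A $ i $ j)
    = density lborel (normal_density 0 (sqrt ((if i = j then 2 else 1) / real CARD('n))))"
proof -
  let ?d = "real CARD('n)"
  let ?M = "gauss :: (real ^ 'n ^ 'n) measure"
  interpret prob_space ?M by (rule prob_space_gauss)
  let ?e = "\<lambda>i j. axis i (axis j 1) :: real ^ 'n ^ 'n"
  have e: "?e i j \<in> Basis" for i j by (auto simp: Basis_vec_def)
  have entry: "A \<bullet> ?e i j = A $ i $ j" for A i j by (simp add: inner_axis)
  have N: "distributed ?M lborel (\<lambda>A. A $ i $ j) std_normal_density" for i j
  proof -
    have "distr ?M lborel (\<lambda>A. A \<bullet> ?e i j) = density lborel std_normal_density"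
      using distr_gauss_component[OF e, of i j] by (simp cong: distr_cong)
    then show ?thesis unfolding entry by (simp add: distributed_def)
  qed
  have "distributed ?M lborel (\<lambda>A. symmat A $ i $ j)
    (normal_density 0 (sqrt ((if i = j then 2 else 1) / ?d)))"
  proof (cases "i = j")
    case True
    have "distributed ?M lborel (\<lambda>A. 0 + (2 / sqrt (2 * ?d)) * (A $ i $ j))
      (normal_density (0 + (2 / sqrt (2 * ?d)) * 0) (\<bar>2 / sqrt (2 * ?d)\<bar> * 1))"
      by (intro normal_density_affine N) auto
    moreover have "\<bar>2 / sqrt (2 * ?d)\<bar> = sqrt (2 / ?d)"
      by (rule power2_eq_imp_eq) (auto simp: power_divide)
    ultimately show ?thesis using True by (simp add: symmat_nth)
  next
    case False
    have ij: "?e i j \<noteq> ?e j i" using False by (auto simp: axis_eq_axis)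
    have "indep_var borel ((\<lambda>f. f (?e i j)) \<circ> (\<lambda>A. restrict (\<lambda>b. A \<bullet> b) {?e i j}))
        borel ((\<lambda>f. f (?e j i)) \<circ> (\<lambda>A. restrict (\<lambda>b. A \<bullet> b) {?e j i}))"
      using ij e
      by (intro indep_var_compose[OF indep_var_restrict[OF indep_vars_gauss]]) auto
    then have ind: "indep_var borel (\<lambda>A. A $ i $ j) borel (\<lambda>A :: real ^ 'n ^ 'n. A $ j $ i)"
      by (simp add: comp_def entry)
    have "distributed ?M lborel (\<lambda>A. 0 + (1 / sqrt (2 * ?d)) * (A $ i $ j + A $ j $ i))
      (normal_density (0 + (1 / sqrt (2 * ?d)) * (0 + 0)) (\<bar>1 / sqrt (2 * ?d)\<bar> * sqrt (1\<^sup>2 + 1\<^sup>2)))"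
      by (intro normal_density_affine add_indep_normal N ind) auto
    moreover have "\<bar>1 / sqrt (2 * ?d)\<bar> * sqrt (1\<^sup>2 + 1\<^sup>2) = sqrt (1 / ?d)"
      by (rule power2_eq_imp_eq) (auto simp: power_divide power_mult_distrib)
    ultimately show ?thesis using False by (simp add: symmat_nth)
  qed
  then show ?thesis
    by (simp add: distributed_distr_eq_density[symmetric] cong: distr_cong)
qed

text \<open>The entry at \<open>(i, j)\<close> with \<open>i \<le> j\<close> uses only the
  coordinates in \<open>K (i, j)\<close>, and these sets are disjoint. Independence of the Gaussian
  coordinates therefore makes the law of the upper triangle a product measure, and symmetry fills in
  the rest.\<close>

lemma goe_eq_distr_gauss:
  "(goe :: (real ^ 'n::{finite,linorder} ^ 'n::{finite,linorder}) measure) = distr gauss borel symmat"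
proof -
  let ?M = "gauss :: (((real, 'n) vec, 'n) vec) measure"
  let ?I = "{(i, j :: 'n). i \<le> j}"
  let ?N = "\<lambda>(i, j :: 'n). density lborel (normal_density 0 (sqrt ((if i = j then 2 else 1) / real CARD('n))))"
  let ?X = "\<lambda>p (A :: ((real, 'n) vec, 'n) vec). symmat A $ fst p $ snd p"
  let ?F = "\<lambda>x. (\<chi> i j. x (min i j, max i j)) :: ((real, 'n) vec, 'n) vec"
  interpret prob_space ?M by (rule prob_space_gauss)
  define e where "e i j = (axis i (axis j 1) :: ((real, 'n) vec, 'n) vec)" for i j
  have e: "e i j \<in> Basis" for i j by (auto simp: Basis_vec_def e_def)
  have entry: "A \<bullet> e i j = A $ i $ j" for A i j by (simp add: inner_axis e_def)
  define K where "K p = {e (fst p) (snd p), e (snd p) (fst p)}" for p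
  define Y where "Y p f = (f (e (fst p) (snd p)) + f (e (snd p) (fst p))) / sqrt (2 * real CARD('n))"
    for p :: "'n \<times> 'n" and f :: "((real, 'n) vec, 'n) vec \<Rightarrow> real"
  have inj: "e i j = e i' j' \<longleftrightarrow> i = i' \<and> j = j'" for i j i' j'
    by (auto simp: e_def axis_eq_axis)
  have "indep_vars (\<lambda>_. borel) (\<lambda>p A. Y p (restrict (\<lambda>b. A \<bullet> b) (K p))) ?I"
  proof (rule indep_vars_compose2[where Y=Y])
    show "indep_vars (\<lambda>p. PiM (K p) (\<lambda>_. borel)) (\<lambda>p A. restrict (\<lambda>b. A \<bullet> b) (K p)) ?I"
    proof (rule indep_vars_restrict[OF indep_vars_gauss])
      show "disjoint_family_on K ?I"
        by (auto simp: disjoint_family_on_def K_def inj)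
    qed (auto simp: K_def e)
    show "Y p \<in> PiM (K p) (\<lambda>_. borel) \<rightarrow>\<^sub>M borel" for p
      unfolding Y_def by (intro borel_measurable_divide borel_measurable_add measurable_component_singleton) (auto simp: K_def)
  qed
  then have "indep_vars (\<lambda>_. borel) ?X ?I"
    by (simp add: Y_def K_def entry symmat_nth)
  moreover have "?X p \<in> borel_measurable ?M" for p
    using measurable_compose[OF measurable_symmat borel_measurable_matrix_nth] by simp
  ultimately have *: "distr ?M (PiM ?I (\<lambda>_. borel)) (\<lambda>A. \<lambda>p\<in>?I. ?X p A) = PiM ?I (\<lambda>p. distr ?M borel (?X p))"
    by (subst (asm) indep_vars_iff_distr_eq_PiM') auto
  also have "\<dots> = PiM ?I ?N"
    by (intro PiM_cong) (auto simp: distr_gauss_symmat_entry)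
  finally have P: "PiM ?I ?N = distr ?M (PiM ?I (\<lambda>_. borel)) (\<lambda>A. \<lambda>p\<in>?I. ?X p A)" ..
  have SP: "sets (PiM ?I ?N) = sets (PiM ?I (\<lambda>_. borel))"
    by (intro sets_PiM_cong) auto
  have "?F \<in> borel_measurable (PiM ?I ?N)"
    by (rule measurable_upper_to_matrix)
  then have [measurable]: "?F \<in> PiM ?I (\<lambda>_. borel) \<rightarrow>\<^sub>M borel"
    unfolding measurable_cong_sets[OF SP refl] .
  have XM [measurable]: "(\<lambda>A. \<lambda>p\<in>?I. ?X p A) \<in> ?M \<rightarrow>\<^sub>M PiM ?I (\<lambda>_. borel)"
    by (intro measurable_restrict) (use measurable_compose[OF measurable_symmat borel_measurable_matrix_nth] in simp)
  have "goe = distr ?M borel (\<lambda>A. ?F (\<lambda>p\<in>?I. ?X p A))"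
    unfolding goe_def P by (subst distr_distr) (auto simp: comp_def)
  also have "(\<lambda>A. ?F (\<lambda>p\<in>?I. ?X p A)) = symmat"
    by (auto simp: fun_eq_iff vec_eq_iff symmat_nth min_def max_def add.commute)
  finally show ?thesis .
qed

section \<open>Resampling the unobserved block\<close>

definition compress :: "real ^ 'n ^ 'n \<Rightarrow> real ^ 'n ^ 'n \<Rightarrow> real ^ 'n ^ 'n"
  where "compress P A = P ** A ** P"

lemma linear_compress: "linear (compress P)"
proof (rule linearI)
  have r: "(A + B) ** P = A ** P + B ** P" for A B :: "real ^ 'a ^ 'a"
    by (vector matrix_matrix_mult_def sum.distrib[symmetric] field_simps)
  show "compress P (A + B) = compress P A + compress P B" for A B
    by (simp only: compress_def matrix_add_ldistrib r)
  show "compress P (c *\<^sub>R A) = c *\<^sub>R compress P A" for c A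
    by (simp only: compress_def matrix_scalar_ac scalar_matrix_assoc)
qed

lemma compress_compress: "compress P (compress Q A) = P ** Q ** A ** (Q ** P)"
  by (simp add: compress_def matrix_mul_assoc)

lemma inner_matrix_mult_left:
  fixes P A B :: "real ^ 'n ^ 'n"
  shows "(P ** A) \<bullet> B = A \<bullet> (transpose P ** B)"
proof -
  have "(P ** A) \<bullet> B = (\<Sum>i\<in>UNIV. \<Sum>j\<in>UNIV. \<Sum>k\<in>UNIV. P $ i $ k * A $ k $ j * B $ i $ j)"
    by (simp add: inner_vec_def matrix_matrix_mult_def sum_distrib_right)
  also have "\<dots> = (\<Sum>j\<in>UNIV. \<Sum>k\<in>UNIV. \<Sum>i\<in>UNIV. P $ i $ k * A $ k $ j * B $ i $ j)"
    by (rule trans[OF sum.swap], rule sum.cong[OF refl], rule sum.swap)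
  also have "\<dots> = (\<Sum>k\<in>UNIV. \<Sum>j\<in>UNIV. \<Sum>i\<in>UNIV. P $ i $ k * A $ k $ j * B $ i $ j)"
    by (rule sum.swap)
  also have "\<dots> = A \<bullet> (transpose P ** B)"
    by (simp add: inner_vec_def matrix_matrix_mult_def transpose_def sum_distrib_left mult_ac)
  finally show ?thesis .
qed

lemma inner_transpose: "transpose A \<bullet> transpose B = A \<bullet> B" for A B :: "real ^ 'n ^ 'm"
  unfolding inner_vec_def transpose_def by (simp, rule sum.swap)

lemma inner_matrix_mult_right:
  fixes P A B :: "real ^ 'n ^ 'n"
  shows "(A ** P) \<bullet> B = A \<bullet> (B ** transpose P)"
proof -
  have "(A ** P) \<bullet> B = (transpose P ** transpose A) \<bullet> transpose B"
    by (simp only: inner_transpose[of "A ** P", symmetric] matrix_transpose_mul)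
  also have "\<dots> = transpose A \<bullet> (P ** transpose B)"
    by (simp only: inner_matrix_mult_left transpose_transpose)
  also have "P ** transpose B = transpose (B ** transpose P)"
    by (simp only: matrix_transpose_mul transpose_transpose)
  finally show ?thesis by (simp only: inner_transpose)
qed

lemma inner_compress:
  assumes "transpose P = P"
  shows "compress P A \<bullet> B = A \<bullet> compress P B"
  unfolding compress_def inner_matrix_mult_right[where A="P ** A"] inner_matrix_mult_left[where A=A] assms
  by (simp only: matrix_mul_assoc)

text \<open>Pythagoras: under these assumptions \<open>compress P\<close> is an orthogonal
  projection for the Frobenius inner product.\<close>

lemma norm_diff_compress:
  assumes "transpose P = P" "P ** P = P"
  shows "(norm (S - compress P S))\<^sup>2 = (norm S)\<^sup>2 - (norm (compress P S))\<^sup>2"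
proof -
  have "compress P S \<bullet> compress P S = S \<bullet> compress P S"
    unfolding inner_compress[OF assms(1)] compress_compress assms(2)
    by (simp add: compress_def matrix_mul_assoc[symmetric] assms(2))
  then show ?thesis
    unfolding power2_norm_eq_inner by (simp add: inner_diff_left inner_diff_right inner_commute[of "compress P S" S])
qed

lemma outer_mult_vec: "outer x y *v u = (y \<bullet> u) *\<^sub>R x"
  by (simp add: outer_def vec_eq_iff matrix_vector_mult_def inner_vec_def sum_distrib_left sum_distrib_right mult_ac)

lemma transpose_outer: "transpose (outer x x) = outer x x"
  by (simp add: outer_def transpose_def vec_eq_iff mult.commute)

lemma compress_outer:
  assumes "transpose P = P"
  shows "compress P (outer x x) = outer (P *v x) (P *v x)"
proof -
  have P: "P $ i $ j = P $ j $ i" for i j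
    using arg_cong[OF assms, of "\<lambda>A. A $ j $ i"] by (simp add: transpose_def)
  show ?thesis
    by (simp add: compress_def outer_def vec_eq_iff matrix_matrix_mult_def matrix_vector_mult_def
        sum_distrib_left sum_distrib_right mult_ac P)
qed

lemma norm_outer: "norm (outer x x) = (norm x)\<^sup>2" for x :: "real ^ 'n"
proof -
  have "(norm (outer x x))\<^sup>2 = ((norm x)\<^sup>2)\<^sup>2"
    unfolding power2_norm_eq_inner
    by (simp add: inner_vec_def outer_def power2_eq_square sum_distrib_left sum_distrib_right mult_ac)
  then show ?thesis by (rule power2_eq_imp_eq) auto
qed

text \<open>Converts between the two scales of the spike: strength \<open>lam\<close> after
  symmetrisation requires \<open>c = lam * sqrt (d / 2)\<close> before it.\<close>

lemma symmat_outer: "symmat (c *\<^sub>R outer u u) = (c * sqrt (2 / real CARD('n))) *\<^sub>R outer u u"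
  for u :: "real ^ 'n"
proof -
  have "2 / sqrt (2 * real CARD('n)) = sqrt (2 / real CARD('n))"
    by (rule power2_eq_imp_eq) (auto simp: power_divide)
  moreover have "symmat (c *\<^sub>R outer u u) $ i $ j = (c * (u $ i * u $ j)) * (2 / sqrt (2 * real CARD('n)))" for i j
    by (simp add: symmat_nth outer_def field_simps)
  ultimately show ?thesis
    by (simp add: vec_eq_iff outer_def)
qed

lemma transpose_symmat: "transpose (symmat A) = symmat A"
  by (simp add: vec_eq_iff transpose_def symmat_nth add.commute)

text \<open>Both \<open>compress P A\<close> and its transpose have \<open>P\<close> as the
  rightmost factor. This is why exchanging the block leaves the answers to earlier queries
  unchanged.\<close>

lemma symmat_compress_mult_vec:
  assumes "transpose P = P" "P *v v = 0"
  shows "symmat (compress P A) *v v = 0"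
proof -
  have "transpose (compress P A) = compress P (transpose A)"
    by (simp add: compress_def matrix_transpose_mul assms(1) matrix_mul_assoc)
  then have "symmat (compress P A) *v v
    = (1 / sqrt (2 * real CARD('a))) *\<^sub>R (compress P A *v v + compress P (transpose A) *v v)"
    by (simp add: symmat_def matrix_vector_mult_add_rdistrib scaleR_matrix_vector_assoc[symmetric])
  then show ?thesis
    by (simp add: compress_def matrix_vector_mul_assoc[symmetric] assms(2))
qed

lemma borel_measurable_matrix_mult [measurable]:
  "(\<lambda>(A :: real ^ 'n ^ 'm, B :: real ^ 'k ^ 'n). A ** B) \<in> borel_measurable (borel \<Otimes>\<^sub>M borel)"
  unfolding matrix_matrix_mult_def borel_prod split_def
  by (intro borel_measurable_continuous_onI continuous_intros)

lemma borel_measurable_compress [measurable]: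
  "(\<lambda>(P, A). compress P A) \<in> borel_measurable (borel \<Otimes>\<^sub>M borel)"
  unfolding compress_def by measurable

lemma query_gram_mult_vec:
  "query_gram z k *v u = (\<Sum>j\<in>{1..k}. (fst (z j) \<bullet> u) *\<^sub>R fst (z j))"
proof -
  have "(\<Sum>j\<in>J. outer (fst (z j)) (fst (z j))) *v u = (\<Sum>j\<in>J. (fst (z j) \<bullet> u) *\<^sub>R fst (z j))"
    if "finite J" for J
    using that by induction (simp_all add: matrix_vector_mult_add_rdistrib outer_mult_vec)
  then show ?thesis unfolding query_gram_def by simp
qed

lemma inner_query_gram:
  "u \<bullet> (query_gram z k *v u) = (\<Sum>j\<in>{1..k}. (fst (z j) \<bullet> u)\<^sup>2)"
  by (simp add: query_gram_mult_vec inner_sum_right power2_eq_square inner_commute)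

lemma transpose_query_gram: "transpose (query_gram z k) = query_gram z k"
proof -
  have "transpose (\<Sum>j\<in>J. outer (fst (z j)) (fst (z j))) = (\<Sum>j\<in>J. outer (fst (z j)) (fst (z j)))"
    if "finite J" for J
    using that
    by induction (simp_all add: transpose_outer, simp_all add: transpose_def vec_eq_iff outer_def mult.commute)
  then show ?thesis unfolding query_gram_def by simp
qed

lemma query_gram_cong:
  "(\<And>j. j \<in> {1..k} \<Longrightarrow> fst (z j) = fst (z' j)) \<Longrightarrow> query_gram z k = query_gram z' k"
  unfolding query_gram_def by (intro sum.cong) auto

text \<open>Later rounds only write at later indices, so all queries can be read off from the single
  run of \<open>N\<close> rounds.\<close>

lemma run_prefix:
  assumes "i \<le> k" "k \<le> m"
  shows "run q M m i = run q M k i"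
  using assms(2)
proof (induction m rule: dec_induct)
  case (step m)
  then show ?case using assms(1) by (simp add: Let_def)
qed simp

lemma fst_run_Suc: "fst (run q M (Suc k) (Suc k)) = q k (run q M k)"
  by (simp add: Let_def)

text \<open>The algorithm sees the matrix only through its products with the queries it has played;
  by induction both runs play the same ones.\<close>

lemma run_cong:
  assumes "\<And>j. j \<in> {1..k} \<Longrightarrow> M' *v fst (run q M k j) = M *v fst (run q M k j)"
  shows "run q M' k = run q M k"
  using assms
proof (induction k)
  case (Suc k)
  have eq: "run q M' k = run q M k"
  proof (rule Suc.IH)
    fix j assume j: "j \<in> {1..k}"
    then have "run q M (Suc k) j = run q M k j" by (intro run_prefix) auto
    then show "M' *v fst (run q M k j) = M *v fst (run q M k j)"
      using Suc.prems[of j] j by simp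
  qed
  have "M' *v q k (run q M k) = M *v q k (run q M k)"
    using Suc.prems[of "Suc k"] by (simp add: fst_run_Suc del: run.simps)
  then show ?case by (simp add: eq Let_def)
qed simp

section \<open>Invariance of the run and of the Gaussian law under resampling\<close>

context
  fixes N :: nat and q :: "nat \<Rightarrow> 'n history \<Rightarrow> real ^ 'n::finite"
  assumes alg: "query_algorithm N q"
begin

definition query :: "real ^ 'n ^ 'n \<Rightarrow> nat \<Rightarrow> real ^ 'n"
  where "query M j = fst (run q M N j)"

definition unseen :: "nat \<Rightarrow> real ^ 'n ^ 'n \<Rightarrow> real ^ 'n ^ 'n"
  where "unseen k M = mat 1 - query_gram (run q M N) k"

definition resample :: "nat \<Rightarrow> real ^ 'n ^ 'n \<Rightarrow> real ^ 'n ^ 'n \<Rightarrow> real ^ 'n ^ 'n"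
  where "resample k A B = A - compress (unseen k (symmat A)) A + compress (unseen k (symmat A)) B"

lemma inner_query:
  assumes "transpose M = M" "i \<in> {1..N}" "j \<in> {1..N}"
  shows "query M i \<bullet> query M j = (if i = j then 1 else 0)"
proof -
  have u: "norm (query M i) = 1" "\<forall>j\<in>{1..<i}. query M i \<bullet> query M j = 0" if "i \<in> {1..N}" for i
    using alg assms(1) that unfolding query_algorithm_def query_def by auto
  consider "i = j" | "i < j" | "j < i" by linarith
  then show ?thesis
    using u(1)[OF assms(2)] u(2)[OF assms(2)] u(2)[OF assms(3)] assms(2,3)
    by cases (auto simp: norm_eq_1 inner_commute)
qed

lemma unseen_mult_vec: "unseen k M *v u = u - (\<Sum>j\<in>{1..k}. (query M j \<bullet> u) *\<^sub>R query M j)"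
  by (simp add: unseen_def matrix_vector_mult_diff_rdistrib query_gram_mult_vec query_def)

lemma transpose_unseen: "transpose (unseen k M) = unseen k M"
proof -
  have "transpose (unseen k M) = transpose (mat 1) - transpose (query_gram (run q M N) k)"
    unfolding unseen_def by (simp add: transpose_def vec_eq_iff)
  then show ?thesis by (simp add: transpose_query_gram unseen_def)
qed

lemma inner_query_sum:
  assumes "transpose M = M" "i \<in> {1..N}" "k \<le> N"
  shows "query M i \<bullet> (\<Sum>j\<in>{1..k}. (query M j \<bullet> u) *\<^sub>R query M j)
    = (if i \<le> k then query M i \<bullet> u else 0)"
proof -
  have "query M i \<bullet> (\<Sum>j\<in>{1..k}. (query M j \<bullet> u) *\<^sub>R query M j)
    = (\<Sum>j\<in>{1..k}. if j = i then query M i \<bullet> u else 0)"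
    unfolding inner_sum_right using assms by (intro sum.cong) (auto simp: inner_query)
  then show ?thesis using assms by simp
qed

lemma unseen_query:
  assumes "transpose M = M" "i \<in> {1..N}" "k \<le> N"
  shows "unseen k M *v query M i = (if i \<le> k then 0 else query M i)"
proof -
  have "(\<Sum>j\<in>{1..k}. (query M j \<bullet> query M i) *\<^sub>R query M j)
    = (\<Sum>j\<in>{1..k}. if j = i then query M i else 0)"
    using assms by (intro sum.cong) (auto simp: inner_query)
  then show ?thesis using assms by (simp add: unseen_mult_vec)
qed

text \<open>The complements shrink as \<open>k\<close> grows, so the range of the later projection
  lies in that of the earlier one; transposing gives the other order. The case \<open>i = k\<close>
  is idempotence.\<close>

lemma unseen_mult_unseen:
  assumes "transpose M = M" "i \<le> k" "k \<le> N"
  shows "unseen i M ** unseen k M = unseen k M" "unseen k M ** unseen i M = unseen k M"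
proof -
  show *: "unseen i M ** unseen k M = unseen k M"
  proof (subst matrix_eq, intro allI)
    fix u
    have "(\<Sum>j\<in>{1..i}. (query M j \<bullet> (unseen k M *v u)) *\<^sub>R query M j) = 0"
    proof (rule sum.neutral, intro ballI)
      fix j assume j: "j \<in> {1..i}"
      then have "query M j \<bullet> (unseen k M *v u) = 0"
        using assms inner_query_sum[of M j k u] by (simp add: unseen_mult_vec inner_diff_right)
      then show "(query M j \<bullet> (unseen k M *v u)) *\<^sub>R query M j = 0" by simp
    qed
    then show "unseen i M ** unseen k M *v u = unseen k M *v u"
      by (simp add: matrix_vector_mul_assoc[symmetric] unseen_mult_vec[of i])
  qed
  then show "unseen k M ** unseen i M = unseen k M"
    by (metis matrix_transpose_mul transpose_unseen)
qed

lemma norm_unseen: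
  assumes "transpose M = M" "k \<le> N"
  shows "(norm (unseen k M *v u))\<^sup>2 = (norm u)\<^sup>2 - u \<bullet> (query_gram (run q M N) k *v u)"
proof -
  have "(norm (unseen k M *v u))\<^sup>2 = u \<bullet> (unseen k M *v u)"
    unfolding power2_norm_eq_inner
    by (metis assms dot_lmul_matrix le_refl matrix_vector_mul_assoc transpose_matrix_vector
        transpose_unseen unseen_mult_unseen(1))
  then show ?thesis
    by (simp add: unseen_def matrix_vector_mult_diff_rdistrib inner_diff_right power2_norm_eq_inner)
qed

lemma symmat_resample:
  "symmat (resample k A B)
    = symmat A + symmat (compress (unseen k (symmat A)) (B - A))"
  by (simp add: resample_def linear_add[OF linear_symmat] linear_diff[OF linear_symmat]
      linear_diff[OF linear_compress])

text \<open>Resampling adds a symmetrised compression, which vanishes on the first \<open>k\<close>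
  queries since the projection annihilates them.\<close>

lemma run_resample:
  assumes k: "k \<le> N"
  shows "run q (symmat (resample k A B)) k = run q (symmat A) k"
proof (rule run_cong)
  fix j assume j: "j \<in> {1..k}"
  have "fst (run q (symmat A) k j) = query (symmat A) j"
    unfolding query_def using j k by (subst run_prefix[of j k N]) auto
  moreover have "unseen k (symmat A) *v query (symmat A) j = 0"
    using j k by (subst unseen_query) (auto simp: transpose_symmat)
  ultimately show "symmat (resample k A B) *v fst (run q (symmat A) k j)
      = symmat A *v fst (run q (symmat A) k j)"
    by (simp add: symmat_resample matrix_vector_mult_add_rdistrib symmat_compress_mult_vec transpose_unseen)
qed

text \<open>The range reaches \<open>Suc k\<close>, one beyond the rounds that are kept: the next
  query is a function of the first \<open>k\<close> rounds. Hence the next overlap, too, ignores the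
  exchanged block.\<close>

lemma query_resample:
  assumes "k \<le> N" "j \<le> Suc k" "j \<in> {1..N}"
  shows "query (symmat (resample k A B)) j = query (symmat A) j"
proof (cases "j = Suc k")
  case True
  then have "query M j = q k (run q M k)" for M
    using run_prefix[of "Suc k" "Suc k" N q M] assms(3) by (simp add: query_def fst_run_Suc del: run.simps)
  then show ?thesis by (simp add: run_resample assms(1))
next
  case False
  then have "query M j = fst (run q M k j)" for M
    using run_prefix[of j k N q M] assms by (simp add: query_def)
  then show ?thesis by (simp add: run_resample assms(1))
qed

lemma query_gram_resample:
  assumes "k \<le> N" "i \<le> Suc k" "i \<le> N"
  shows "query_gram (run q (symmat (resample k A B)) N) i = query_gram (run q (symmat A) N) i"
  using query_resample[of k] assms by (intro query_gram_cong) (auto simp: query_def)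

lemma unseen_resample:
  assumes "k \<le> N" "i \<le> Suc k" "i \<le> N"
  shows "unseen i (symmat (resample k A B)) = unseen i (symmat A)"
  using query_gram_resample[OF assms] by (simp add: unseen_def)

text \<open>The next projection is determined by \<open>A\<close> alone, as the next query is, and
  lies below the current one. It annihilates the retained part of \<open>A\<close>, so the second
  resampling acts only inside the copy \<open>B\<close>.\<close>

lemma resample_resample:
  assumes k: "Suc k \<le> N"
  defines "P \<equiv> \<lambda>A. unseen (Suc k) (symmat A)"
  shows "resample (Suc k) (resample k A B) C = resample k A (B - compress (P A) B + compress (P A) C)"
proof -
  have PP: "unseen k (symmat A) ** P A = P A" "P A ** unseen k (symmat A) = P A"
    using k unfolding P_def by (intro unseen_mult_unseen; simp add: transpose_symmat)+
  have absorb: "compress (unseen k (symmat A)) (compress (P A) X) = compress (P A) X"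
    "compress (P A) (compress (unseen k (symmat A)) X) = compress (P A) X" for X
    unfolding compress_compress PP by (simp_all add: compress_def)
  have "P (resample k A B) = P A"
    unfolding P_def using k by (intro unseen_resample) auto
  then have "resample (Suc k) (resample k A B) C
    = resample k A B - compress (P A) (resample k A B) + compress (P A) C"
    by (simp add: resample_def[of "Suc k"] P_def)
  also have "compress (P A) (resample k A B) = compress (P A) B"
    unfolding resample_def
    by (simp add: linear_add[OF linear_compress] linear_diff[OF linear_compress] absorb)
  finally show ?thesis
    unfolding resample_def
    by (simp add: linear_add[OF linear_compress] linear_diff[OF linear_compress] absorb)
qed

lemma measurable_query_gram_run [measurable]:
  assumes "k \<le> N"
  shows "(\<lambda>M. query_gram (run q M N) k) \<in> borel_measurable borel"
  using measurable_compose[OF measurable_run[OF alg order_refl] borel_measurable_query_gram[OF assms]] .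

lemma measurable_unseen [measurable]:
  assumes "k \<le> N"
  shows "unseen k \<in> borel_measurable borel"
  unfolding unseen_def using measurable_query_gram_run[OF assms] by measurable

lemma measurable_resample [measurable]:
  assumes "k \<le> N"
  shows "case_prod (resample k) \<in> borel_measurable (borel \<Otimes>\<^sub>M borel)"
proof -
  note [measurable] = measurable_unseen[OF assms]
  show ?thesis unfolding resample_def by measurable
qed

text \<open>
  The projection depends on \<open>A\<close>, so the static statement \<open>gauss_resample\<close> does not apply directly.
  In the induction the next block is resampled inside the copy drawn for the previous one, where
  the next projection is a constant.
\<close>

lemma gauss_resample_unseen:
  assumes "k \<le> N" and "F \<in> borel_measurable borel"
  shows "(\<integral>\<^sup>+ A. \<integral>\<^sup>+ B. F (resample k A B) \<partial>gauss \<partial>gauss) = (\<integral>\<^sup>+ A. F A \<partial>gauss)"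
  using assms
proof (induction k arbitrary: F)
  case 0
  interpret prob_space "gauss :: (real ^ 'n ^ 'n) measure" by (rule prob_space_gauss)
  \<comment> \<open>Before any query the projection is the identity, so the copy replaces the whole
    matrix.\<close>
  have "resample 0 A B = B" for A B
    by (simp add: resample_def unseen_def query_gram_def compress_def)
  then show ?case using emeasure_space_1 by simp
next
  case (Suc k)
  interpret prob_space "gauss :: (real ^ 'n ^ 'n) measure" by (rule prob_space_gauss)
  from Suc.prems have k: "k \<le> N" and [measurable]: "F \<in> borel_measurable borel" by auto
  note [measurable] = measurable_resample[OF k] measurable_resample[OF Suc.prems(1)]
  have [measurable]: "resample k A \<in> borel_measurable borel" for A
    using measurable_compose[OF measurable_Pair1' measurable_resample[OF k], of A] by simp
  have "(\<integral>\<^sup>+ A. F A \<partial>gauss) = (\<integral>\<^sup>+ A. \<integral>\<^sup>+ B. F (resample k A B) \<partial>gauss \<partial>gauss)"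
    using Suc.IH[OF k, of F] by simp
  also have "\<dots> = (\<integral>\<^sup>+ A. \<integral>\<^sup>+ B. \<integral>\<^sup>+ C. F (resample (Suc k) (resample k A B) C) \<partial>gauss \<partial>gauss \<partial>gauss)"
  proof (rule nn_integral_cong)
    fix A :: "real ^ 'n ^ 'n"
    let ?P = "unseen (Suc k) (symmat A)"
    have "(\<integral>\<^sup>+ B. F (resample k A B) \<partial>gauss)
      = (\<integral>\<^sup>+ B. \<integral>\<^sup>+ C. F (resample k A (B - compress ?P B + compress ?P C)) \<partial>gauss \<partial>gauss)"
    proof (rule gauss_resample[symmetric])
      have "?P ** ?P = ?P"
        using Suc.prems(1) by (intro unseen_mult_unseen) (auto simp: transpose_symmat)
      then show "compress ?P (compress ?P X) = compress ?P X" for X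
        unfolding compress_compress by (simp add: compress_def matrix_mul_assoc[symmetric])
    qed (auto simp: linear_compress inner_compress transpose_unseen)
    then show "(\<integral>\<^sup>+ B. F (resample k A B) \<partial>gauss)
      = (\<integral>\<^sup>+ B. \<integral>\<^sup>+ C. F (resample (Suc k) (resample k A B) C) \<partial>gauss \<partial>gauss)"
      by (simp add: resample_resample[OF Suc.prems(1)])
  qed
  \<comment> \<open>The induction hypothesis is used backwards, with the inner integral in place of
    \<open>F\<close>, to merge \<open>resample k A B\<close> into one Gaussian matrix.\<close>
  also have "\<dots> = (\<integral>\<^sup>+ A. \<integral>\<^sup>+ C. F (resample (Suc k) A C) \<partial>gauss \<partial>gauss)"
    by (rule Suc.IH[OF k, where F="\<lambda>K. \<integral>\<^sup>+ C. F (resample (Suc k) K C) \<partial>gauss"]) measurable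
  finally show ?case by simp
qed

text \<open>As \<open>G\<close> ignores the fresh block, the Cameron-Martin density may be averaged
  over it. The Gaussian moment generating function contributes half the squared norm of the
  compressed spike, which reduces \<open>norm S\<close> to \<open>norm (R A)\<close>.\<close>

lemma gauss_shift_unseen:
  fixes S :: "real ^ 'n ^ 'n"
  assumes k: "k \<le> N" and G [measurable]: "G \<in> borel_measurable borel"
    and inv: "\<And>A B. G (resample k A B) = G A"
  defines "R \<equiv> \<lambda>A. S - compress (unseen k (symmat A)) S"
  shows "(\<integral>\<^sup>+ A. G (A + S) \<partial>gauss)
    = (\<integral>\<^sup>+ A. G A * ennreal (exp (R A \<bullet> A - (norm (R A))\<^sup>2 / 2)) \<partial>gauss)"
proof -
  note [measurable] = measurable_resample[OF k]
  have "(\<integral>\<^sup>+ A. G (A + S) \<partial>gauss)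
    = (\<integral>\<^sup>+ A. G A * ennreal (exp (S \<bullet> A - (norm S)\<^sup>2 / 2)) \<partial>gauss)"
    by (rule gauss_cameron_martin) measurable
  also have "\<dots> = (\<integral>\<^sup>+ A. \<integral>\<^sup>+ B. G (resample k A B)
      * ennreal (exp (S \<bullet> resample k A B - (norm S)\<^sup>2 / 2)) \<partial>gauss \<partial>gauss)"
    by (rule gauss_resample_unseen[symmetric, OF k]) measurable
  also have "\<dots> = (\<integral>\<^sup>+ A. G A * ennreal (exp (R A \<bullet> A - (norm (R A))\<^sup>2 / 2)) \<partial>gauss)"
  proof (rule nn_integral_cong)
    fix A :: "real ^ 'n ^ 'n"
    let ?P = "unseen k (symmat A)"
    have tr: "transpose ?P = ?P" by (rule transpose_unseen)
    have id: "?P ** ?P = ?P"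
      using k by (intro unseen_mult_unseen) (auto simp: transpose_symmat)
    have e: "exp (S \<bullet> resample k A B - (norm S)\<^sup>2 / 2)
      = exp (R A \<bullet> A - (norm S)\<^sup>2 / 2) * exp (compress ?P S \<bullet> B)" for B
      by (simp add: exp_add[symmetric] resample_def R_def inner_diff_left inner_diff_right
          inner_add_right inner_compress[OF tr])
    have "(\<integral>\<^sup>+ B. G (resample k A B) * ennreal (exp (S \<bullet> resample k A B - (norm S)\<^sup>2 / 2)) \<partial>gauss)
      = (\<integral>\<^sup>+ B. G A * ennreal (exp (R A \<bullet> A - (norm S)\<^sup>2 / 2)) * ennreal (exp (compress ?P S \<bullet> B)) \<partial>gauss)"
      by (simp add: inv e ennreal_mult mult.assoc)
    also have "\<dots> = G A * ennreal (exp (R A \<bullet> A - (norm S)\<^sup>2 / 2)) * ennreal (exp ((norm (compress ?P S))\<^sup>2 / 2))"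
      by (simp add: nn_integral_cmult gauss_mgf)
    also have "\<dots> = G A * ennreal (exp (R A \<bullet> A - (norm S)\<^sup>2 / 2) * exp ((norm (compress ?P S))\<^sup>2 / 2))"
      by (simp add: ennreal_mult mult.assoc)
    also have "exp (R A \<bullet> A - (norm S)\<^sup>2 / 2) * exp ((norm (compress ?P S))\<^sup>2 / 2)
      = exp (R A \<bullet> A - (norm (R A))\<^sup>2 / 2)"
      unfolding R_def norm_diff_compress[OF tr id] by (simp add: exp_add[symmetric] field_simps)
    finally show "(\<integral>\<^sup>+ B. G (resample k A B) * ennreal (exp (S \<bullet> resample k A B - (norm S)\<^sup>2 / 2)) \<partial>gauss)
      = G A * ennreal (exp (R A \<bullet> A - (norm (R A))\<^sup>2 / 2))" .
  qed
  finally show ?thesis .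
qed

end

section \<open>Threshold crossings\<close>

context
  fixes N :: nat and q :: "nat \<Rightarrow> 'n history \<Rightarrow> real ^ 'n::finite"
  assumes alg: "query_algorithm N q"
begin

definition overlap :: "nat \<Rightarrow> real ^ 'n \<Rightarrow> real ^ 'n ^ 'n \<Rightarrow> real"
  where "overlap k u M = u \<bullet> (query_gram (run q M N) k *v u)"

lemma measurable_overlap:
  assumes "k \<le> N" and [measurable]: "f \<in> borel_measurable M" "h \<in> borel_measurable M"
  shows "(\<lambda>x. overlap k (f x) (h x)) \<in> borel_measurable M"
proof -
  have [measurable]: "(\<lambda>x. query_gram (run q (h x) N) k) \<in> borel_measurable M"
    using measurable_compose[OF assms(3) measurable_query_gram_run[OF alg assms(1)]] .
  show ?thesis unfolding overlap_def by measurable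
qed

text \<open>The compressed spike has norm \<open>c\<close> times the squared norm of the projected
  \<open>u\<close>, that is \<open>c * (1 - overlap)\<close>. Pythagoras leaves
  \<open>1 - (1 - x)\<^sup>2 \<le> 2 * x\<close> for the overlap \<open>x\<close>.\<close>

lemma norm_observed_spike_le:
  assumes u: "norm u = 1" and k: "k \<le> N" and c: "0 \<le> c" and M: "transpose M = M"
  defines "S \<equiv> c *\<^sub>R outer u u"
  shows "(norm (S - compress (unseen N q k M) S))\<^sup>2 \<le> 2 * c\<^sup>2 * overlap k u M"
proof -
  let ?P = "unseen N q k M"
  have tr: "transpose ?P = ?P" by (rule transpose_unseen[OF alg])
  have id: "?P ** ?P = ?P" using unseen_mult_unseen[OF alg M order_refl k] by simp
  have nP: "(norm (?P *v u))\<^sup>2 = 1 - overlap k u M"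
    using norm_unseen[OF alg M k, of u] u by (simp add: overlap_def)
  have "compress ?P S = c *\<^sub>R outer (?P *v u) (?P *v u)"
    unfolding S_def by (simp add: linear_scale[OF linear_compress] compress_outer[OF tr])
  then have "(norm (compress ?P S))\<^sup>2 = c\<^sup>2 * (1 - overlap k u M)\<^sup>2"
    using nP by (simp add: norm_outer power_mult_distrib)
  moreover have "(norm S)\<^sup>2 = c\<^sup>2"
    using u by (simp add: S_def norm_outer power_mult_distrib)
  ultimately have "(norm (S - compress ?P S))\<^sup>2 = c\<^sup>2 * (1 - (1 - overlap k u M)\<^sup>2)"
    unfolding norm_diff_compress[OF tr id] by (simp add: algebra_simps)
  also have "\<dots> \<le> c\<^sup>2 * (2 * overlap k u M)"
    by (intro mult_left_mono) (simp_all add: power2_eq_square algebra_simps)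
  finally show ?thesis by simp
qed

text \<open>
  With \<open>L\<close> the likelihood ratio of the observations, \<open>L \<le> exp a + exp (a - p a) L\<^sup>p\<close>, and
  \<open>E L\<^sup>p\<close> is controlled because \<open>L\<^sup>p\<close> is, up to a factor bounded on \<open>B\<close>, the likelihood ratio
  belonging to the spike \<open>p S\<close>.
\<close>

lemma spiked_emeasure_le:
  assumes u: "norm u = 1" and k: "k \<le> N" and c: "0 \<le> c" and p: "1 < p"
    and B [measurable]: "B \<in> sets borel"
    and inv: "\<And>A C. resample N q k A C \<in> B \<longleftrightarrow> A \<in> B"
    and small: "\<And>A. A \<in> B \<Longrightarrow> 2 * c\<^sup>2 * overlap k u (symmat A) \<le> \<tau>"
  shows "emeasure gauss {A. A + c *\<^sub>R outer u u \<in> B}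
    \<le> ennreal (exp a) * emeasure gauss B + ennreal (exp ((1 - p) * a + (p\<^sup>2 - p) * \<tau> / 2))"
proof -
  interpret prob_space "gauss :: (real ^ 'n ^ 'n) measure" by (rule prob_space_gauss)
  define S where "S = c *\<^sub>R outer u u"
  define R where "R A = S - compress (unseen N q k (symmat A)) S" for A
  define y where "y A = R A \<bullet> A - (norm (R A))\<^sup>2 / 2" for A
  note [measurable] = measurable_unseen[OF alg k]
  have [measurable]: "R \<in> borel_measurable borel" unfolding R_def by measurable
  have [measurable]: "y \<in> borel_measurable borel" unfolding y_def by measurable
  let ?G = "indicator B :: real ^ 'n ^ 'n \<Rightarrow> ennreal"
  have G [measurable]: "?G \<in> borel_measurable borel" by measurable
  \<comment> \<open>For \<open>r = 1\<close> this is the probability to be bounded. For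
    \<open>r = p\<close> the integral is the tilted moment, and being a probability it is at most
    1.\<close>
  have shift: "emeasure gauss {A. A + r *\<^sub>R S \<in> B}
    = (\<integral>\<^sup>+ A. ?G A * ennreal (exp (r * (R A \<bullet> A) - r\<^sup>2 * (norm (R A))\<^sup>2 / 2)) \<partial>gauss)" for r
  proof -
    have Rr: "r *\<^sub>R S - compress (unseen N q k (symmat A)) (r *\<^sub>R S) = r *\<^sub>R R A" for A
      by (simp add: R_def linear_scale[OF linear_compress] scaleR_diff_right)
    have "{A. A + r *\<^sub>R S \<in> B} = (\<lambda>A. A + r *\<^sub>R S) -` B \<inter> space borel" by auto
    also have "\<dots> \<in> sets borel" by (rule measurable_sets[where A=borel]) auto
    finally have "emeasure gauss {A. A + r *\<^sub>R S \<in> B} = (\<integral>\<^sup>+ A. indicator {A. A + r *\<^sub>R S \<in> B} A \<partial>gauss)"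
      by (subst nn_integral_indicator) auto
    also have "\<dots> = (\<integral>\<^sup>+ A. ?G (A + r *\<^sub>R S) \<partial>gauss)"
      by (simp add: indicator_def)
    also have "\<dots> = (\<integral>\<^sup>+ A. ?G A * ennreal (exp (r *\<^sub>R R A \<bullet> A - (norm (r *\<^sub>R R A))\<^sup>2 / 2)) \<partial>gauss)"
      using gauss_shift_unseen[OF alg k G, of "r *\<^sub>R S"] inv unfolding Rr by (simp add: indicator_def)
    finally show ?thesis by (simp add: power_mult_distrib)
  qed
  have "emeasure gauss {A. A + c *\<^sub>R outer u u \<in> B} = (\<integral>\<^sup>+ A. ?G A * ennreal (exp (y A)) \<partial>gauss)"
    using shift[of 1] by (simp add: S_def y_def)
  also have "\<dots> \<le> (\<integral>\<^sup>+ A. ennreal (exp a) * ?G A + ennreal (exp ((1 - p) * a + (p\<^sup>2 - p) * \<tau> / 2))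
      * (?G A * ennreal (exp (p * (R A \<bullet> A) - p\<^sup>2 * (norm (R A))\<^sup>2 / 2))) \<partial>gauss)"
  proof (rule nn_integral_mono)
    fix A :: "real ^ 'n ^ 'n"
    show "?G A * ennreal (exp (y A)) \<le> ennreal (exp a) * ?G A + ennreal (exp ((1 - p) * a + (p\<^sup>2 - p) * \<tau> / 2))
      * (?G A * ennreal (exp (p * (R A \<bullet> A) - p\<^sup>2 * (norm (R A))\<^sup>2 / 2)))"
    proof (cases "A \<in> B")
      case True
      have "(norm (R A))\<^sup>2 \<le> 2 * c\<^sup>2 * overlap k u (symmat A)"
        unfolding R_def S_def by (rule norm_observed_spike_le[OF u k c transpose_symmat])
      also have "\<dots> \<le> \<tau>" by (rule small[OF True])
      finally have "(p\<^sup>2 - p) * (norm (R A))\<^sup>2 \<le> (p\<^sup>2 - p) * \<tau>"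
        using p by (intro mult_left_mono) (auto simp: power2_eq_square)
      moreover have "p * y A = p * (R A \<bullet> A) - p\<^sup>2 * (norm (R A))\<^sup>2 / 2 + (p\<^sup>2 - p) * (norm (R A))\<^sup>2 / 2"
        by (simp add: y_def algebra_simps diff_divide_distrib)
      ultimately have py: "p * y A \<le> p * (R A \<bullet> A) - p\<^sup>2 * (norm (R A))\<^sup>2 / 2 + (p\<^sup>2 - p) * \<tau> / 2"
        by linarith
      have "exp (y A) \<le> exp a + exp ((1 - p) * a + p * y A)"
      proof (cases "y A \<le> a")
        case True
        then show ?thesis by (simp add: add_increasing2)
      next
        case False
        then have "0 \<le> (p - 1) * (y A - a)" using p by simp
        then have "y A \<le> (1 - p) * a + p * y A" by (simp add: algebra_simps)
        then show ?thesis by (simp add: add_increasing)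
      qed
      also have "\<dots> \<le> exp a + exp ((1 - p) * a + (p\<^sup>2 - p) * \<tau> / 2)
          * exp (p * (R A \<bullet> A) - p\<^sup>2 * (norm (R A))\<^sup>2 / 2)"
        using py by (simp add: exp_add[symmetric])
      finally show ?thesis
        using True by (simp add: ennreal_mult[symmetric] ennreal_plus[symmetric] del: ennreal_plus)
    qed simp
  qed
  also have "\<dots> = ennreal (exp a) * emeasure gauss B
      + ennreal (exp ((1 - p) * a + (p\<^sup>2 - p) * \<tau> / 2)) * emeasure gauss {A. A + p *\<^sub>R S \<in> B}"
    unfolding shift by (subst nn_integral_add) (simp_all add: nn_integral_cmult)
  also have "\<dots> \<le> ennreal (exp a) * emeasure gauss B
      + ennreal (exp ((1 - p) * a + (p\<^sup>2 - p) * \<tau> / 2)) * 1"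
    by (intro add_left_mono mult_left_mono emeasure_le_1) auto
  finally show ?thesis by simp
qed

lemma null_overlap_le:
  assumes k: "k \<le> N" and x: "0 < x" and \<beta>: "0 \<le> \<beta>" "\<beta> < 1"
  shows "(\<integral>\<^sup>+ u. emeasure gauss {A. x \<le> overlap k u (symmat A)} \<partial>uniform_sphere)
    \<le> ennreal (exp (- \<beta> * x * real CARD('n) / 2) * (1 - \<beta>) powr (- real k / 2))"
proof -
  let ?U = "uniform_sphere :: (real ^ 'n) measure" and ?M = "gauss :: (real ^ 'n ^ 'n) measure"
  interpret U: prob_space ?U by (rule prob_space_uniform_sphere)
  interpret M: prob_space ?M by (rule prob_space_gauss)
  interpret P: pair_prob_space ?U ?M ..
  let ?Q = "{z. x \<le> overlap k (fst z) (symmat (snd z))}"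
  have [simp]: "space ?U = UNIV" by (simp add: uniform_sphere_def)
  have "{z \<in> space (?U \<Otimes>\<^sub>M ?M). x \<le> overlap k (fst z) (symmat (snd z))} \<in> sets (?U \<Otimes>\<^sub>M ?M)"
  proof -
    have [measurable]: "(\<lambda>z. overlap k (fst z) (symmat (snd z))) \<in> borel_measurable (?U \<Otimes>\<^sub>M ?M)"
      by (intro measurable_overlap k) measurable
    show ?thesis by measurable
  qed
  then have Q: "?Q \<in> sets (?U \<Otimes>\<^sub>M ?M)" by (simp add: space_pair_measure)
  have "(\<integral>\<^sup>+ u. emeasure ?M {A. x \<le> overlap k u (symmat A)} \<partial>?U) = emeasure (?U \<Otimes>\<^sub>M ?M) ?Q"
    by (subst M.emeasure_pair_measure_alt[OF Q]) (simp add: vimage_def)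
  \<comment> \<open>With the noise fixed the queries are constant orthonormal vectors, because
    \<open>symmat A\<close> is symmetric; only then is the average over the sphere taken.\<close>
  also have "\<dots> = (\<integral>\<^sup>+ A. emeasure ?U {u. x \<le> overlap k u (symmat A)} \<partial>?M)"
    by (subst P.emeasure_pair_measure_alt2[OF Q]) (simp add: vimage_def)
  also have "\<dots> \<le> (\<integral>\<^sup>+ A. ennreal (exp (- \<beta> * x * real CARD('n) / 2) * (1 - \<beta>) powr (- real k / 2)) \<partial>?M)"
  proof (rule nn_integral_mono)
    fix A :: "real ^ 'n ^ 'n"
    have orth: "query N q (symmat A) i \<bullet> query N q (symmat A) j = (if i = j then 1 else 0)"
      if "i \<in> {1..k}" "j \<in> {1..k}" for i j
      using that k by (intro inner_query[OF alg transpose_symmat]) auto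
    have "emeasure ?U {u. x \<le> (\<Sum>i\<in>{1..k}. (query N q (symmat A) i \<bullet> u)\<^sup>2)}
      \<le> ennreal (exp (- \<beta> * x * real CARD('n) / 2) * (1 - \<beta>) powr (- real (card {1..k}) / 2))"
      using orth by (intro uniform_sphere_overlap x \<beta>) (auto simp: norm_eq_1)
    then show "emeasure ?U {u. x \<le> overlap k u (symmat A)}
      \<le> ennreal (exp (- \<beta> * x * real CARD('n) / 2) * (1 - \<beta>) powr (- real k / 2))"
      by (simp add: overlap_def inner_query_gram query_def[OF alg])
  qed
  also have "\<dots> = ennreal (exp (- \<beta> * x * real CARD('n) / 2) * (1 - \<beta>) powr (- real k / 2))"
    by (simp add: M.emeasure_space_1[simplified])
  finally show ?thesis .
qed

text \<open>A set of unsymmetrised matrices, so that the spike acts as a Gaussian shift. Control of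
  round \<open>k\<close> alone is asked for, since the overlap then bounds the whole observed part
  of the spike.\<close>

definition crossing :: "nat \<Rightarrow> real \<Rightarrow> real \<Rightarrow> real \<Rightarrow> real ^ 'n \<Rightarrow> (real ^ 'n ^ 'n) set"
  where "crossing k \<tau> \<tau>' lam u =
    {A. overlap k u (symmat A + lam *\<^sub>R outer u u) \<le> \<tau> / real CARD('n)
      \<and> \<tau>' / real CARD('n) \<le> overlap (Suc k) u (symmat A + lam *\<^sub>R outer u u)}"

lemma sets_crossing:
  assumes "Suc k \<le> N"
  shows "{z. snd z \<in> crossing k \<tau> \<tau>' lam (fst z)} \<in> sets (borel \<Otimes>\<^sub>M borel)"
proof -
  have m: "(\<lambda>z. overlap i (fst z) (symmat (snd z) + lam *\<^sub>R outer (fst z) (fst z)))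
      \<in> borel_measurable (borel \<Otimes>\<^sub>M borel)" if "i \<le> N" for i
    using that by (intro measurable_overlap) measurable
  note [measurable] = m[OF assms] m[OF Suc_leD[OF assms]]
  have "{z \<in> space (borel \<Otimes>\<^sub>M borel). snd z \<in> crossing k \<tau> \<tau>' lam (fst z)} \<in> sets (borel \<Otimes>\<^sub>M borel)"
    unfolding crossing_def mem_Collect_eq by measurable
  then show ?thesis by (simp add: space_pair_measure)
qed

lemma measurable_emeasure_crossing:
  assumes "Suc k \<le> N"
  shows "(\<lambda>u. emeasure gauss (crossing k \<tau> \<tau>' lam u)) \<in> borel_measurable borel"
proof -
  interpret prob_space "gauss :: (real ^ 'n ^ 'n) measure" by (rule prob_space_gauss)
  have "sets (borel \<Otimes>\<^sub>M borel) = sets (borel \<Otimes>\<^sub>M (gauss :: (real ^ 'n ^ 'n) measure))"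
    by (intro sets_pair_measure_cong) auto
  then show ?thesis
    using measurable_emeasure_Pair[of "{z. snd z \<in> crossing k \<tau> \<tau>' lam (fst z)}" borel] sets_crossing[OF assms]
    by (simp add: vimage_def)
qed

lemma measurable_crossing:
  assumes "Suc k \<le> N"
  shows "crossing k \<tau> \<tau>' lam u \<in> sets borel"
  using sets_Pair1[OF sets_crossing[OF assms], of u] by (simp add: vimage_def)

lemma crossing_le:
  assumes k: "Suc k \<le> N" and lam: "0 \<le> lam" and p: "1 < p"
    and \<tau>': "0 < \<tau>'" and \<beta>: "0 \<le> \<beta>" "\<beta> < 1"
  shows "(\<integral>\<^sup>+ u. emeasure gauss (crossing k \<tau> \<tau>' lam u) \<partial>uniform_sphere)
    \<le> ennreal (exp a * (exp (- \<beta> * \<tau>' / 2) * (1 - \<beta>) powr (- real (Suc k) / 2))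
        + exp ((1 - p) * a + (p\<^sup>2 - p) * (lam\<^sup>2 * \<tau>) / 2))"
proof -
  let ?d = "real CARD('n)" and ?U = "uniform_sphere :: (real ^ 'n) measure"
  interpret U: prob_space ?U by (rule prob_space_uniform_sphere)
  define c where "c = lam * sqrt (?d / 2)"
  have c: "0 \<le> c" "c\<^sup>2 = lam\<^sup>2 * ?d / 2" using lam by (auto simp: c_def power_mult_distrib)
  have c': "c * sqrt (2 / ?d) = lam" by (simp add: c_def real_sqrt_mult[symmetric])
  let ?T = "ennreal (exp ((1 - p) * a + (p\<^sup>2 - p) * (lam\<^sup>2 * \<tau>) / 2))"
  let ?B' = "\<lambda>u. {A. \<tau>' / ?d \<le> overlap (Suc k) u (symmat A)}"
  have mB': "(\<lambda>u. emeasure gauss (?B' u)) \<in> borel_measurable ?U"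
  proof -
    interpret prob_space "gauss :: (real ^ 'n ^ 'n) measure" by (rule prob_space_gauss)
    have [measurable]: "(\<lambda>z. overlap (Suc k) (fst z) (symmat (snd z)))
      \<in> borel_measurable (?U \<Otimes>\<^sub>M (gauss :: (real ^ 'n ^ 'n) measure))"
      using k by (intro measurable_overlap) measurable
    have "{z \<in> space (?U \<Otimes>\<^sub>M gauss). \<tau>' / ?d \<le> overlap (Suc k) (fst z) (symmat (snd z))}
      \<in> sets (?U \<Otimes>\<^sub>M (gauss :: (real ^ 'n ^ 'n) measure))" by measurable
    from measurable_emeasure_Pair[OF this] show ?thesis
      by (simp add: vimage_def space_pair_measure uniform_sphere_def)
  qed
  have "(\<integral>\<^sup>+ u. emeasure gauss (crossing k \<tau> \<tau>' lam u) \<partial>?U)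
    \<le> (\<integral>\<^sup>+ u. ennreal (exp a) * emeasure gauss (?B' u) + ?T \<partial>?U)"
  proof (rule nn_integral_mono_AE, use AE_uniform_sphere in eventually_elim)
    fix u :: "real ^ 'n" assume u: "norm u = 1"
    define B where "B = {A. overlap k u (symmat A) \<le> \<tau> / ?d \<and> \<tau>' / ?d \<le> overlap (Suc k) u (symmat A)}"
    have B: "B \<in> sets borel"
    proof -
      have m: "(\<lambda>A. overlap i u (symmat A)) \<in> borel_measurable borel" if "i \<le> N" for i
        using that by (intro measurable_overlap) measurable
      note [measurable] = m[OF k] m[OF Suc_leD[OF k]]
      have "{A \<in> space borel. overlap k u (symmat A) \<le> \<tau> / ?d \<and> \<tau>' / ?d \<le> overlap (Suc k) u (symmat A)} \<in> sets borel"
        by measurable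
      then show ?thesis by (simp add: B_def)
    qed
    have sub: "B \<subseteq> ?B' u" by (auto simp: B_def)
    have B': "?B' u \<in> sets gauss"
    proof -
      have [measurable]: "(\<lambda>A. overlap (Suc k) u (symmat A)) \<in> borel_measurable borel"
        using k by (intro measurable_overlap) measurable
      have "{A \<in> space borel. \<tau>' / ?d \<le> overlap (Suc k) u (symmat A)} \<in> sets borel" by measurable
      then show ?thesis by simp
    qed
    have "symmat A + lam *\<^sub>R outer u u = symmat (A + c *\<^sub>R outer u u)" for A
      by (simp add: linear_add[OF linear_symmat] symmat_outer c')
    then have "crossing k \<tau> \<tau>' lam u = {A. A + c *\<^sub>R outer u u \<in> B}"
      by (simp add: crossing_def B_def)
    also have "emeasure gauss \<dots> \<le> ennreal (exp a) * emeasure gauss B + ?T"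
    proof (rule spiked_emeasure_le[OF u _ c(1) p B])
      show "k \<le> N" using k by simp
      \<comment> \<open>\<open>B\<close> involves the overlap after \<open>Suc k\<close> rounds, yet
        only the first \<open>k\<close> rounds are kept; this works because overlaps depend on the
        queries and not on the last answer.\<close>
      show "resample N q k A C \<in> B \<longleftrightarrow> A \<in> B" for A C
        using k by (simp add: B_def overlap_def query_gram_resample[OF alg])
      show "2 * c\<^sup>2 * overlap k u (symmat A) \<le> lam\<^sup>2 * \<tau>" if "A \<in> B" for A
      proof -
        have "?d * overlap k u (symmat A) \<le> \<tau>" using that by (simp add: B_def field_simps)
        then have "lam\<^sup>2 * (?d * overlap k u (symmat A)) \<le> lam\<^sup>2 * \<tau>" by (intro mult_left_mono) auto
        then show ?thesis by (simp add: c(2))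
      qed
    qed
    \<comment> \<open>The condition on round \<open>k\<close> has been spent on the moment bound;
      the null term keeps only the next overlap.\<close>
    also have "\<dots> \<le> ennreal (exp a) * emeasure gauss (?B' u) + ?T"
      by (intro add_right_mono mult_left_mono emeasure_mono sub B') auto
    finally show "emeasure gauss (crossing k \<tau> \<tau>' lam u) \<le> ennreal (exp a) * emeasure gauss (?B' u) + ?T" .
  qed
  also have "\<dots> = ennreal (exp a) * (\<integral>\<^sup>+ u. emeasure gauss (?B' u) \<partial>?U) + ?T"
    using mB' by (subst nn_integral_add) (simp_all add: nn_integral_cmult U.emeasure_space_1)
  also have "\<dots> \<le> ennreal (exp a) * ennreal (exp (- \<beta> * \<tau>' / 2) * (1 - \<beta>) powr (- real (Suc k) / 2)) + ?T"
    using null_overlap_le[OF k, of "\<tau>' / ?d" \<beta>] \<tau>' \<beta>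
    by (intro add_right_mono mult_left_mono) auto
  also have "\<dots> = ennreal (exp a * (exp (- \<beta> * \<tau>' / 2) * (1 - \<beta>) powr (- real (Suc k) / 2))
        + exp ((1 - p) * a + (p\<^sup>2 - p) * (lam\<^sup>2 * \<tau>) / 2))"
    by (simp add: ennreal_mult[symmetric] ennreal_plus[symmetric] del: ennreal_plus)
  finally show ?thesis .
qed

end

section \<open>Arithmetic of the exponents and summation over the rounds\<close>

text \<open>The left side is the balanced exponent for \<open>p = lam\<close>, where
  \<open>D = 1 - 1 / p\<close>. The moment cost equals
  \<open>D * (1 - D) * \<tau> (Suc k) / 2\<close>, so any \<beta> above \<open>1 - D\<close> leaves
  a net gain; \<beta> is the midpoint \<open>1 - D / 2\<close> between \<open>1 - D\<close> and 1,
  which leaves \<open>D\<^sup>2 * \<tau> (Suc k) / 4\<close>.\<close>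

lemma crossing_exponent:
  fixes lam g L :: real and k :: nat
  assumes lam: "1 < lam" and g: "g = (lam - 1)\<^sup>2 / (lam\<^sup>2 + 1)" and L: "0 \<le> L"
  defines "D \<equiv> 1 - 1 / lam" and "\<tau> \<equiv> \<lambda>k. 32 * lam ^ (4 * k) * (inverse g * (L + g powr (- 1 / 2)))"
  shows "(lam - 1) * lam\<^sup>2 * \<tau> k / 2
      + D * (- (1 - D / 2) * \<tau> (Suc k) / 2 + real (Suc k) / 2 * ln (2 / D)) \<le> - 8 * L - 31 * real (Suc k)"
proof -
  let ?j = "real (Suc k)" and ?h = "g powr (- 1 / 2)"
  have D: "0 < D" "D < 1" using lam by (auto simp: D_def)
  have g0: "0 < g" using lam unfolding g by (intro divide_pos_pos) (auto intro: add_nonneg_pos)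
  have lamD: "lam * D = lam - 1" using lam by (simp add: D_def field_simps)
  have \<tau>Suc: "\<tau> (Suc k) = lam ^ 4 * \<tau> k" by (simp add: \<tau>_def power_add)
  have eq: "(lam - 1) * lam\<^sup>2 * \<tau> k = D * (1 - D) * \<tau> (Suc k)"
  proof -
    have "lam * (1 - D) = 1" using lam by (simp add: D_def)
    then have "D * (1 - D) * lam ^ 4 = (lam * D) * lam\<^sup>2"
      by (simp add: power2_eq_square power4_eq_xxxx) (metis mult.assoc mult.commute mult_1)
    then show ?thesis by (simp add: lamD \<tau>Suc mult.assoc[symmetric])
  qed
  have "(lam - 1) * lam\<^sup>2 * \<tau> k / 2
      + D * (- (1 - D / 2) * \<tau> (Suc k) / 2 + ?j / 2 * ln (2 / D))
    = - (D\<^sup>2 * \<tau> (Suc k)) / 4 + ?j * (D / 2 * ln (2 / D))"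
    unfolding eq by (simp add: field_simps power2_eq_square)
  also have "\<dots> \<le> - (8 * L + 32 * ?j) + ?j * 1"
  proof (intro add_mono mult_left_mono)
    have "ln (2 / D) \<le> 2 / D" using D ln_bound[of "2 / D"] by simp
    then have "D / 2 * ln (2 / D) \<le> D / 2 * (2 / D)" using D by (intro mult_left_mono) auto
    then show "D / 2 * ln (2 / D) \<le> 1" using D by simp
    \<comment> \<open>The summand \<open>g powr (- 1 / 2)\<close> of the threshold pays for the
      dimension of the queried subspace: it offsets the factor \<open>lam - 1\<close> that
      Bernoulli's inequality leaves in the growth of \<open>lam ^ (4 * Suc k)\<close>.\<close>
    have h: "?h * (lam - 1) = sqrt (lam\<^sup>2 + 1)"
    proof -
      have "?h = 1 / sqrt g" using g0 by (simp add: powr_minus_divide powr_half_sqrt)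
      also have "sqrt g = (lam - 1) / sqrt (lam\<^sup>2 + 1)"
        using lam unfolding g by (simp add: real_sqrt_divide)
      finally show ?thesis using lam by simp
    qed
    have h1: "1 \<le> ?h * (lam - 1)" unfolding h by (simp add: real_le_rsqrt)
    have h0: "0 < ?h" using g0 by simp
    have bern: "1 + real (4 * Suc k) * (lam - 1) \<le> lam ^ (4 * Suc k)"
      using Bernoulli_inequality[of "lam - 1" "4 * Suc k"] lam by simp
    \<comment> \<open>The constant 32 in the threshold, divided by 4, gives the 8 here. Of the
      resulting \<open>32 * ?j\<close>, one \<open>?j\<close> covers the logarithmic term and 31
      remain for summability.\<close>
    have "8 * L + 32 * ?j \<le> 8 * (L * 1) + 8 * (?h * (4 * ?j * (lam - 1)))"
    proof -
      have "4 * ?j * 1 \<le> 4 * ?j * (?h * (lam - 1))" using h1 by (intro mult_left_mono) auto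
      also have "\<dots> = ?h * (4 * ?j * (lam - 1))" by (simp only: mult_ac)
      finally show ?thesis by linarith
    qed
    also have "\<dots> \<le> 8 * (L * lam ^ (4 * Suc k)) + 8 * (?h * lam ^ (4 * Suc k))"
      using bern lam L h0 by (intro add_mono mult_left_mono one_le_power) auto
    also have "\<dots> = g * \<tau> (Suc k) / 4"
      using g0 by (simp add: \<tau>_def field_simps)
    also have "\<dots> \<le> D\<^sup>2 * \<tau> (Suc k) / 4"
    proof -
      have "g \<le> D\<^sup>2"
      proof -
        have "D = (lam - 1) / lam" using lam by (simp add: D_def diff_divide_distrib)
        then have "D\<^sup>2 = (lam - 1)\<^sup>2 / lam\<^sup>2" by (simp only: power_divide)
        moreover have "(lam - 1)\<^sup>2 / (lam\<^sup>2 + 1) \<le> (lam - 1)\<^sup>2 / lam\<^sup>2"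
          using lam by (intro divide_left_mono) (auto intro!: mult_pos_pos add_nonneg_pos)
        ultimately show ?thesis unfolding g by simp
      qed
      moreover have "0 \<le> \<tau> (Suc k)" using lam g0 L h0 by (auto simp: \<tau>_def intro!: mult_nonneg_nonneg)
      ultimately show ?thesis by (intro divide_right_mono mult_right_mono) auto
    qed
    finally show "- (D\<^sup>2 * \<tau> (Suc k)) / 4 \<le> - (8 * L + 32 * ?j)" by simp
  qed auto
  finally show ?thesis by simp
qed

text \<open>The factor 2 stands for the two equal terms of the balanced bound, and
  \<open>exp (- 31) \<le> 1 / 4\<close> absorbs it with room to spare.\<close>

lemma two_exp_minus_le_half_power: "2 * exp (- 31 * real (Suc k)) \<le> (1 / 2) ^ Suc k"
proof -
  have "exp (- 31 * real (Suc k)) = exp (- 31) ^ Suc k"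
    by (metis exp_of_nat_mult mult.commute)
  also have "\<dots> \<le> (1 / 4 :: real) ^ Suc k"
  proof (intro power_mono)
    have "(4::real) \<le> exp 31" using exp_ge_add_one_self[of "31::real"] by linarith
    then show "exp (- 31) \<le> (1 / 4 :: real)" by (simp add: exp_minus field_simps)
  qed simp
  finally have "2 * exp (- 31 * real (Suc k)) \<le> 2 * (1 / 4) ^ Suc k" by simp
  also have "\<dots> = ((1 / 2) ^ k * (1 / 2) ^ k) / 2"
    unfolding power_mult_distrib[symmetric] by simp
  also have "\<dots> = (1 / 2) ^ k * (1 / 2) ^ Suc k" by simp
  also have "\<dots> \<le> 1 * (1 / 2) ^ Suc k" by (intro mult_right_mono power_le_one) simp_all
  finally show ?thesis by simp
qed

theorem theorem3p2:
  fixes lam g \<delta> :: real and N :: nat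
    and q :: "nat \<Rightarrow> 'n history \<Rightarrow> real ^ 'n::{finite,linorder}"
  assumes "lam > 1" and "g = (lam - 1)\<^sup>2 / (lam\<^sup>2 + 1)"
    and "query_algorithm N q"
    and "0 < \<delta>" and "\<delta> < 1 / exp 1"
  shows "(\<integral>\<^sup>+ u. emeasure (history_law N q lam u)
      {z \<in> space (history_space N). \<exists>k\<in>{1..N}.
        u \<bullet> (query_gram z k *v u)
          \<ge> 32 * lam ^ (4 * k) * (inverse g * (ln (1 / \<delta>) + g powr (- 1 / 2)) / real CARD('n))}
      \<partial>uniform_sphere) \<le> ennreal \<delta>"
proof -
  note lam = assms(1) and g = assms(2) and alg = assms(3)
  define L where "L = ln (1 / \<delta>)"
  have "1 < exp (1 :: real)" by simp
  then have \<delta>1: "\<delta> < 1" using assms(4,5) by (smt (verit) divide_le_eq_1)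
  have L: "0 \<le> L" "\<delta> = exp (- L)" using assms(4) \<delta>1 by (auto simp: L_def ln_div)
  have g0: "0 < g" using lam unfolding g by (intro divide_pos_pos) (auto intro: add_nonneg_pos)
  define \<tau> where "\<tau> k = 32 * lam ^ (4 * k) * (inverse g * (L + g powr (- 1 / 2)))" for k
  have \<tau>0: "0 < \<tau> k" for k
    using lam g0 L(1) by (auto simp: \<tau>_def intro!: mult_pos_pos add_nonneg_pos)
  let ?E = "\<lambda>k u. crossing N q k (\<tau> k) (\<tau> (Suc k)) lam u"
  let ?ev = "\<lambda>u. {z \<in> space (history_space N). \<exists>k\<in>{1..N}. \<tau> k / real CARD('n) \<le> u \<bullet> (query_gram z k *v u)}"
  have "(\<integral>\<^sup>+ u. emeasure (history_law N q lam u) (?ev u) \<partial>uniform_sphere)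
    \<le> (\<integral>\<^sup>+ u. (\<Sum>k<N. emeasure gauss (?E k u)) \<partial>uniform_sphere)"
  proof (rule nn_integral_mono)
    fix u
    have [measurable]: "(\<lambda>W. run q (W + lam *\<^sub>R outer u u) N) \<in> borel \<rightarrow>\<^sub>M history_space N"
      using measurable_compose[OF _ measurable_run[OF alg order_refl], of "\<lambda>W. W + lam *\<^sub>R outer u u" borel] by simp
    have law: "history_law N q lam u = distr gauss (history_space N) (\<lambda>A. run q (symmat A + lam *\<^sub>R outer u u) N)"
      unfolding history_law_def goe_eq_distr_gauss by (subst distr_distr) (auto simp: comp_def)
    have meas: "(\<lambda>A. run q (symmat A + lam *\<^sub>R outer u u) N) \<in> gauss \<rightarrow>\<^sub>M history_space N"
      by measurable
    show "emeasure (history_law N q lam u) (?ev u) \<le> (\<Sum>k<N. emeasure gauss (?E k u))"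
    \<comment> \<open>\<open>emeasure\<close> is 0 outside the sigma-algebra, so this case split
      takes the place of a measurability proof.\<close>
    proof (cases "?ev u \<in> sets (history_space N)")
      case False
      then show ?thesis by (simp add: law emeasure_notin_sets)
    next
      case True
      have "(\<lambda>A. run q (symmat A + lam *\<^sub>R outer u u) N) -` ?ev u \<inter> space gauss \<subseteq> (\<Union>k<N. ?E k u)"
      proof
        fix A
        let ?o = "\<lambda>k. overlap N q k u (symmat A + lam *\<^sub>R outer u u)"
        assume "A \<in> (\<lambda>A. run q (symmat A + lam *\<^sub>R outer u u) N) -` ?ev u \<inter> space gauss"
        then have ex: "\<exists>k. k \<in> {1..N} \<and> \<tau> k / real CARD('n) \<le> ?o k"
          by (auto simp: overlap_def[OF alg])
        \<comment> \<open>At the first round above its threshold the preceding round is below its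
          own, which puts the matrix into one crossing event.\<close>
        define k where "k = (LEAST k. k \<in> {1..N} \<and> \<tau> k / real CARD('n) \<le> ?o k)"
        have k: "k \<in> {1..N}" "\<tau> k / real CARD('n) \<le> ?o k"
          using LeastI_ex[OF ex] unfolding k_def by auto
        then obtain j where j: "k = Suc j" by (cases k) auto
        have "?o j \<le> \<tau> j / real CARD('n)"
        proof (cases "j = 0")
          \<comment> \<open>Before the first round the overlap is an empty sum, and the threshold at
            index 0 is positive.\<close>
          case True
          then show ?thesis using \<tau>0[of 0] by (simp add: overlap_def[OF alg] query_gram_def)
        next
          case False
          then have "j \<in> {1..N}" using k j by auto
          then show ?thesis
            using not_less_Least[of j "\<lambda>k. k \<in> {1..N} \<and> \<tau> k / real CARD('n) \<le> ?o k"] j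
            unfolding k_def[symmetric] by auto
        qed
        then have "A \<in> ?E j u" using k j by (simp add: crossing_def[OF alg])
        then show "A \<in> (\<Union>k<N. ?E k u)" using k j by auto
      qed
      then have "emeasure (history_law N q lam u) (?ev u) \<le> emeasure gauss (\<Union>k<N. ?E k u)"
        unfolding law emeasure_distr[OF meas True]
        by (intro emeasure_mono) (auto intro!: measurable_crossing[OF alg])
      also have "\<dots> \<le> (\<Sum>k<N. emeasure gauss (?E k u))"
        by (intro emeasure_subadditive_finite) (auto intro!: measurable_crossing[OF alg])
      finally show ?thesis .
    qed
  qed
  also have "\<dots> = (\<Sum>k<N. \<integral>\<^sup>+ u. emeasure gauss (?E k u) \<partial>uniform_sphere)"
    by (intro nn_integral_sum) (auto intro!: measurable_emeasure_crossing[OF alg] simp: measurable_cong_sets[OF sets_uniform_sphere refl])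
  \<comment> \<open>Geometric weights make the total at most \<delta> whatever the number of
    rounds.\<close>
  also have "\<dots> \<le> (\<Sum>k<N. ennreal (\<delta> * (1 / 2) ^ Suc k))"
  proof (rule sum_mono)
    fix k assume "k \<in> {..<N}"
    then have k: "Suc k \<le> N" by auto
    define D where "D = 1 - 1 / lam"
    have D: "0 < D" "D < 1" using lam by (auto simp: D_def)
    \<comment> \<open>\<open>lm\<close> is the logarithm of the moment bound at
      \<open>p = lam\<close>, and \<open>lP\<close> that of the null tail at
      \<open>\<beta> = 1 - D / 2\<close>.\<close>
    define lm where "lm = (lam\<^sup>2 - lam) * (lam\<^sup>2 * \<tau> k) / 2"
    define lP where "lP = - (1 - D / 2) * \<tau> (Suc k) / 2 + real (Suc k) / 2 * ln (2 / D)"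
    \<comment> \<open>the choice of \<open>a\<close> that makes both terms of \<open>crossing_le\<close> equal to \<open>exp e\<close>\<close>
    define a where "a = (lm - lP) / lam"
    define e where "e = (lam - 1) * lam\<^sup>2 * \<tau> k / 2 + D * lP"
    have "exp (- (1 - D / 2) * \<tau> (Suc k) / 2) * (1 - (1 - D / 2)) powr (- real (Suc k) / 2) = exp lP"
      using D by (simp add: lP_def powr_def exp_add[symmetric] ln_div algebra_simps)
    then have "exp a * (exp (- (1 - D / 2) * \<tau> (Suc k) / 2) * (1 - (1 - D / 2)) powr (- real (Suc k) / 2))
      = exp (a + lP)" by (simp add: exp_add)
    moreover have "a + lP = e" "(1 - lam) * a + lm = e"
      using lam by (simp_all add: a_def e_def lm_def D_def field_simps power2_eq_square)
    ultimately have "(\<integral>\<^sup>+ u. emeasure gauss (?E k u) \<partial>uniform_sphere) \<le> ennreal (exp e + exp e)"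
      using crossing_le[OF alg k, of lam lam "\<tau> (Suc k)" "1 - D / 2" "\<tau> k" a] lam D \<tau>0
      by (simp add: lm_def)
    also have "\<dots> \<le> ennreal (\<delta> * (1 / 2) ^ Suc k)"
    proof (rule ennreal_leI)
      have "e \<le> - 8 * L - 31 * real (Suc k)"
        using crossing_exponent[OF lam g L(1), of k] by (simp add: e_def lP_def D_def \<tau>_def)
      also have "\<dots> \<le> - L + - 31 * real (Suc k)" using L(1) by simp
      finally have "exp e \<le> exp (- L) * exp (- 31 * real (Suc k))" by (simp add: exp_add[symmetric])
      then have "exp e + exp e \<le> exp (- L) * (2 * exp (- 31 * real (Suc k)))" by simp
      also have "\<dots> \<le> exp (- L) * (1 / 2) ^ Suc k" by (intro mult_left_mono two_exp_minus_le_half_power) simp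
      finally show "exp e + exp e \<le> \<delta> * (1 / 2) ^ Suc k" using L(2) by simp
    qed
    finally show "(\<integral>\<^sup>+ u. emeasure gauss (?E k u) \<partial>uniform_sphere) \<le> ennreal (\<delta> * (1 / 2) ^ Suc k)" .
  qed
  also have "\<dots> = ennreal (\<delta> * (\<Sum>k<N. (1 / 2) ^ Suc k))"
    using assms(4) by (subst sum_ennreal) (auto simp: sum_distrib_left)
  also have "\<dots> \<le> ennreal \<delta>"
  proof (rule ennreal_leI)
    have "(\<Sum>k<N. (1 / 2 :: real) ^ Suc k) = 1 - (1 / 2) ^ N"
      by (induction N) auto
    then show "\<delta> * (\<Sum>k<N. (1 / 2) ^ Suc k) \<le> \<delta>"
      using assms(4) by (simp add: mult_left_le)
  qed
  finally show ?thesis by (simp add: \<tau>_def L_def)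
qed

end
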